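(* Let $\mathcal B_n(p,q,t)$, $n\ge 0$, be the polynomials in $p,q,t$ defined as the Taylor coefficients in $z$ of the continued fraction $$\sum_{n=0}^{\infty}\mathcal B_n(p,q,t)z^{n}=\cfrac{1}{1-(1+t)z-\cfrac{(p+q)tz^2}{1-p(1+t)z-\cfrac{p^3tz^2}{1-p^2(1+t)z-\cfrac{p^5tz^2}{\ddots}}}}$$ (the coefficient of $z$ at level $h\ge 0$ is $p^h(1+t)$; the first partial numerator is $(p+q)tz^2$ and the $h$-th one, $h\ge2$, is $p^{2h-1}tz^2$). Then for every $n\ge 1$, $$\mathcal B_n(p,q,t)=\sum_{k=0}^{\lfloor n/2\rfloor}\gamma_{n+1,k}(p,q)\,t^k(1+t)^{n-2k},$$ where $$\gamma_{n+1,k}(p,q)=\sum_{\sigma\in\mathfrak S_{n+1,k}}p^{(2\text{-}13)\,\sigma}q^{(31\text{-}2)\,\sigma}$$ and $$\mathfrak S_{n+1,k}=\{\sigma\in\mathfrak S_{n+1}(3124,4123,3142,4132):\ \mathrm{dd}\,\sigma=0,\ \mathrm{val}\,\sigma=\mathrm{des}\,\sigma=k\}.$$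
   Context: $\mathfrak S_m$ is the set of permutations $\sigma=\sigma(1)\cdots\sigma(m)$ of $\{1,\dots,m\}$, and $\mathfrak S_m(3124,4123,3142,4132)$ is the subset of permutations avoiding all four of these classical patterns. $\mathrm{des}\,\sigma$ is the number of $i$ with $1\le i<m$ and $\sigma(i)>\sigma(i+1)$. With the convention $\sigma(0)=\sigma(m+1)=0$, a value $\sigma(i)$, $1\le i\le m$, is a valley if $\sigma(i-1)>\sigma(i)<\sigma(i+1)$ and a double descent if $\sigma(i-1)>\sigma(i)>\sigma(i+1)$; $\mathrm{val}\,\sigma$ and $\mathrm{dd}\,\sigma$ are the numbers of valleys and double descents. Moreover $$(31\text{-}2)\,\sigma=\sum_{i=1}^m\#\{j:1<j<i,\ \sigma(j)<\sigma(i)<\sigma(j-1)\},$$ $$(2\text{-}13)\,\sigma=\sum_{i=1}^m\#\{j: i<j<m,\ \sigma(j)<\sigma(i)<\sigma(j+1)\}.$$ Continued fractions are understood as formal power series in $z$. *)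

theory Defs
  imports
    "HOL-Combinatorics.Permutations"
    "HOL-Computational_Algebra.Polynomial"
    "HOL-Computational_Algebra.Formal_Power_Series"
begin

section \<open>Continued fractions of Jacobi type\<close>

text \<open>
  \<open>J_convergent b c N h\<close> is the continued fraction
  \<open>1 / (1 - b h z - c (h + 1) z^2 / (1 - b (h + 1) z - c (h + 2) z^2 / \<dots>))\<close>
  that starts at level \<open>h\<close> and is cut off after \<open>N\<close> levels. Every denominator has constant
  coefficient \<open>1\<close>, so its reciprocal exists over any commutative ring; \<^const>\<open>inverse\<close> on formal
  power series is not used because it needs an inverse on the coefficients.
\<close>

primrec J_convergent ::
  "(nat \<Rightarrow> 'a::comm_ring_1) \<Rightarrow> (nat \<Rightarrow> 'a) \<Rightarrow> nat \<Rightarrow> nat \<Rightarrow> 'a fps" where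
  "J_convergent b c 0 h = 0"
| "J_convergent b c (Suc N) h =
     fps_right_inverse
       (1 - fps_const (b h) * fps_X
          - fps_const (c (Suc h)) * fps_X ^ 2 * J_convergent b c N (Suc h)) 1"

text \<open>The limit is that of the library topology on formal power series, in which convergence
  means that each coefficient is eventually constant.\<close>

definition J_fraction :: "(nat \<Rightarrow> 'a::comm_ring_1) \<Rightarrow> (nat \<Rightarrow> 'a) \<Rightarrow> 'a fps" where
  "J_fraction b c = lim (\<lambda>N. J_convergent b c N 0)"

lemma J_convergent_Suc_mult:
  "(1 - fps_const (b h) * fps_X
      - fps_const (c (Suc h)) * fps_X ^ 2 * J_convergent b c N (Suc h))
    * J_convergent b c (Suc N) h = 1"
  by (simp add: fps_right_inverse mult.assoc)

lemma J_convergent_stable: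
  "n < N \<Longrightarrow> N \<le> M \<Longrightarrow> fps_nth (J_convergent b c M h) n = fps_nth (J_convergent b c N h) n"
proof (induction N arbitrary: n M h)
  case 0
  then show ?case by simp
next
  case (Suc N)
  then obtain M' where M: "M = Suc M'" "N \<le> M'"
    by (cases M) auto
  let ?d = "\<lambda>L. 1 - fps_const (b h) * fps_X
    - fps_const (c (Suc h)) * fps_X ^ 2 * J_convergent b c L (Suc h)"
  have "fps_nth (?d M') k = fps_nth (?d N) k" if "k \<le> n" for k
    using Suc.IH[of "k - 2" M' "Suc h"] that Suc.prems M
    by (simp add: mult.assoc fps_X_power_mult_nth)
  then have "fps_right_inverse_constructor (?d M') 1 n = fps_right_inverse_constructor (?d N) 1 n"
    by (intro fps_right_inverse_constructor_cong) auto
  then show ?case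
    by (simp add: M)
qed

lemma J_convergent_tendsto: "(\<lambda>N. J_convergent b c N 0) \<longlonglongrightarrow> J_fraction b c"
proof -
  let ?L = "Abs_fps (\<lambda>n. fps_nth (J_convergent b c (Suc n) 0) n)"
  have lim: "(\<lambda>N. J_convergent b c N 0) \<longlonglongrightarrow> ?L"
  proof (rule tendsto_fpsI)
    fix n
    show "\<forall>\<^sub>F M in sequentially. fps_nth (J_convergent b c M 0) n = fps_nth ?L n"
      using eventually_ge_at_top[of "Suc n"]
    proof eventually_elim
      case (elim M)
      then show ?case
        using J_convergent_stable[of n "Suc n" M b c 0] by (simp del: J_convergent.simps)
    qed
  qed
  then show ?thesis
    unfolding J_fraction_def by (simp add: limI del: J_convergent.simps)
qed

lemma J_fraction_nth:
  assumes "n < N"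
  shows "fps_nth (J_fraction b c) n = fps_nth (J_convergent b c N 0) n"
proof -
  obtain M0 where "\<And>M. M \<ge> M0 \<Longrightarrow>
      fps_nth (J_convergent b c M 0) n = fps_nth (J_fraction b c) n"
    using J_convergent_tendsto[of b c]
    by (auto simp: tendsto_fps_iff eventually_at_top_linorder)
  from this[of "max M0 N"] show ?thesis
    using J_convergent_stable[of n N "max M0 N" b c 0] assms by simp
qed

text \<open>
  The value of the polynomial \<open>\<B>\<^sub>n\<close> at elements \<open>p\<close>, \<open>q\<close>, \<open>t\<close> of an arbitrary commutative ring;
  the polynomial itself is obtained by taking the three indeterminates in \<^typ>\<open>int poly poly poly\<close>.
\<close>

definition calB :: "nat \<Rightarrow> 'a::comm_ring_1 \<Rightarrow> 'a \<Rightarrow> 'a \<Rightarrow> 'a" where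
  "calB n p q t =
     fps_nth (J_fraction (\<lambda>h. p ^ h * (1 + t))
       (\<lambda>h. if h = 1 then (p + q) * t else p ^ (2 * h - 1) * t)) n"

section \<open>Permutation statistics\<close>

text \<open>
  A permutation of \<open>{1..m}\<close> is a function \<open>\<sigma>\<close> with \<open>\<sigma> permutes {1..m}\<close>. Since such a function is
  the identity outside \<open>{1..m}\<close>, the convention \<open>\<sigma>(0) = \<sigma>(m+1) = 0\<close> has to be imposed
  separately.
\<close>

definition bordered :: "nat \<Rightarrow> (nat \<Rightarrow> nat) \<Rightarrow> nat \<Rightarrow> nat" where
  "bordered m \<sigma> i = (if i \<in> {1..m} then \<sigma> i else 0)"

definition des :: "nat \<Rightarrow> (nat \<Rightarrow> nat) \<Rightarrow> nat" where
  "des m \<sigma> = card {i. 1 \<le> i \<and> i < m \<and> \<sigma> i > \<sigma> (i + 1)}"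

definition val :: "nat \<Rightarrow> (nat \<Rightarrow> nat) \<Rightarrow> nat" where
  "val m \<sigma> = card {i \<in> {1..m}.
     bordered m \<sigma> (i - 1) > bordered m \<sigma> i \<and> bordered m \<sigma> i < bordered m \<sigma> (i + 1)}"

definition dd :: "nat \<Rightarrow> (nat \<Rightarrow> nat) \<Rightarrow> nat" where
  "dd m \<sigma> = card {i \<in> {1..m}.
     bordered m \<sigma> (i - 1) > bordered m \<sigma> i \<and> bordered m \<sigma> i > bordered m \<sigma> (i + 1)}"

definition stat_31_2 :: "nat \<Rightarrow> (nat \<Rightarrow> nat) \<Rightarrow> nat" where
  "stat_31_2 m \<sigma> = (\<Sum>i = 1..m. card {j. 1 < j \<and> j < i \<and> \<sigma> j < \<sigma> i \<and> \<sigma> i < \<sigma> (j - 1)})"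

definition stat_2_13 :: "nat \<Rightarrow> (nat \<Rightarrow> nat) \<Rightarrow> nat" where
  "stat_2_13 m \<sigma> = (\<Sum>i = 1..m. card {j. i < j \<and> j < m \<and> \<sigma> j < \<sigma> i \<and> \<sigma> i < \<sigma> (j + 1)})"

text \<open>Classical patterns are given as words in one-line notation; list positions start at \<open>0\<close>.\<close>

definition contains_pattern :: "nat \<Rightarrow> (nat \<Rightarrow> nat) \<Rightarrow> nat list \<Rightarrow> bool" where
  "contains_pattern m \<sigma> \<tau> \<longleftrightarrow>
     (\<exists>f. strict_mono_on {..<length \<tau>} f \<and> f ` {..<length \<tau>} \<subseteq> {1..m} \<and>
          (\<forall>a < length \<tau>. \<forall>b < length \<tau>. \<sigma> (f a) < \<sigma> (f b) \<longleftrightarrow> \<tau> ! a < \<tau> ! b))"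

definition avoiders :: "nat \<Rightarrow> nat list set \<Rightarrow> (nat \<Rightarrow> nat) set" where
  "avoiders m P = {\<sigma>. \<sigma> permutes {1..m} \<and> (\<forall>\<tau> \<in> P. \<not> contains_pattern m \<sigma> \<tau>)}"

definition Sset :: "nat \<Rightarrow> nat \<Rightarrow> (nat \<Rightarrow> nat) set" where
  "Sset m k = {\<sigma> \<in> avoiders m {[3,1,2,4], [4,1,2,3], [3,1,4,2], [4,1,3,2]}.
     dd m \<sigma> = 0 \<and> val m \<sigma> = k \<and> des m \<sigma> = k}"

definition gam :: "nat \<Rightarrow> nat \<Rightarrow> 'a::comm_ring_1 \<Rightarrow> 'a \<Rightarrow> 'a" where
  "gam m k p q = (\<Sum>\<sigma> \<in> Sset m k. p ^ stat_2_13 m \<sigma> * q ^ stat_31_2 m \<sigma>)"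

end

theory Submission
  imports Defs
begin

text \<open>
  Contract every maximal block of letters \<open>\<le> i\<close> in the one-line notation of a permutation to a
  zero: the result is a word with \<open>h\<close> zeros in which every larger value occurs once. Without
  double descents, the smallest positive letter of such a word can only be attached to a zero on
  its left (a level step), stand alone and become a new zero (a step between \<open>h\<close> and \<open>h + 1\<close>), or
  join two zeros. The four patterns say that no \<open>c, a, x, y\<close> in this order satisfies
  \<open>a < c\<close>, \<open>a < min x y < c\<close>. This forces the smallest positive letter into the leftmost
  admissible place, with weight a power of \<open>p\<close>; the one exception is a word ending in its only
  zero followed by \<open>1\<close>, which contributes the summand \<open>q\<close> of \<open>p + q\<close>. So the weighted words
  satisfy the recursion of weighted Motzkin paths, whose generating function is the continued
  fraction.
\<close>

subsection \<open>Words with repeated zeros\<close>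

primrec head0 :: "nat list \<Rightarrow> nat" where
  "head0 [] = 0"
| "head0 (x # l) = x"

text \<open>
  \<open>alternating a w\<close>: the word \<open>a w 0\<close> has no double descent at a letter of \<open>w\<close> and no equal
  neighbours. An interior zero is thus a valley, and the final border is supplied by \<open>head0 [] = 0\<close>.
\<close>

primrec alternating :: "nat \<Rightarrow> nat list \<Rightarrow> bool" where
  "alternating a [] \<longleftrightarrow> a \<noteq> 0"
| "alternating a (b # l) \<longleftrightarrow> a \<noteq> b \<and> (b < a \<longrightarrow> b < head0 l) \<and> alternating b l"

text \<open>Two later positions with letters \<open>x\<close>, \<open>y\<close> such that
  \<open>a < min x y < c\<close>. Leaving their order open merges the four patterns into one
  condition.\<close>

definition low_pair :: "nat \<Rightarrow> nat \<Rightarrow> nat list \<Rightarrow> bool" where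
  "low_pair c a l \<longleftrightarrow> 2 \<le> length (filter (\<lambda>x. a < x) l) \<and> (\<exists>x \<in> set l. a < x \<and> x < c)"

primrec avoids_after :: "nat \<Rightarrow> nat list \<Rightarrow> bool" where
  "avoids_after c [] \<longleftrightarrow> True"
| "avoids_after c (a # l) \<longleftrightarrow> \<not> (a < c \<and> low_pair c a l) \<and> avoids_after c l"

primrec avoids :: "nat list \<Rightarrow> bool" where
  "avoids [] \<longleftrightarrow> True"
| "avoids (c # l) \<longleftrightarrow> avoids_after c l \<and> avoids l"

primrec ascents_over :: "nat \<Rightarrow> nat list \<Rightarrow> nat" where
  "ascents_over x [] = 0"
| "ascents_over x (a # l) = of_bool (a < x \<and> x < head0 l) + ascents_over x l"

primrec word_2_13 :: "nat list \<Rightarrow> nat" where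
  "word_2_13 [] = 0"
| "word_2_13 (x # l) = ascents_over x l + word_2_13 l"

text \<open>Reversal turns an adjacent descent followed by a middle value into a middle value
  followed by an adjacent ascent.\<close>

abbreviation word_31_2 :: "nat list \<Rightarrow> nat" where
  "word_31_2 l \<equiv> word_2_13 (rev l)"

text \<open>The test \<open>l \<noteq> []\<close> is there because \<open>head0 [] = 0\<close> would
  otherwise count the drop from the last letter to the border.\<close>

primrec descents :: "nat list \<Rightarrow> nat" where
  "descents [] = 0"
| "descents (a # l) = of_bool (l \<noteq> [] \<and> head0 l < a) + descents l"

definition content :: "nat \<Rightarrow> nat \<Rightarrow> nat list \<Rightarrow> bool" where
  "content N h w \<longleftrightarrow>
     (\<forall>x. count_list w x = (if x = 0 then h else if x \<le> N then 1 else 0))"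

text \<open>Over the alphabet \<open>{0..N}\<close>, with \<open>h\<close> zeros standing for contracted blocks of smaller values.\<close>

definition words :: "nat \<Rightarrow> nat \<Rightarrow> nat list set" where
  "words N h = {w. content N h w \<and> alternating 0 w \<and> avoids w}"

text \<open>The strictly increasing map that fixes 0 and misses exactly 1. It makes room for a new
  smallest positive letter, and whatever is defined by comparing letters is invariant under
  \<open>map lift\<close>.\<close>

definition lift :: "nat \<Rightarrow> nat" where
  "lift x = (if x = 0 then 0 else Suc x)"

lemma lift_simps [simp]:
  "lift 0 = 0" "lift (Suc x) = Suc (Suc x)" "lift x \<noteq> Suc 0" "Suc 0 \<noteq> lift x"
  "lift x = 0 \<longleftrightarrow> x = 0" "0 < lift x \<longleftrightarrow> 0 < x" "Suc 0 < lift x \<longleftrightarrow> 0 < x"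
  "lift x < Suc 0 \<longleftrightarrow> x = 0"
  "lift x < lift y \<longleftrightarrow> x < y" "lift x = lift y \<longleftrightarrow> x = y" "lift x - Suc 0 = x"
  by (auto simp: lift_def)

lemma lift_pred: "x \<noteq> Suc 0 \<Longrightarrow> lift (x - Suc 0) = x"
  by (auto simp: lift_def)

lemma inj_lift: "inj lift"
  by (auto simp: inj_on_def)

lemma ex_map_lift:
  assumes "Suc 0 \<notin> set w"
  obtains v where "w = map lift v"
proof
  show "w = map lift (map (\<lambda>x. x - Suc 0) w)"
    using assms by (induction w) (auto simp: lift_pred)
qed

lemma map_lift_eq_iff [simp]: "map lift v = map lift v' \<longleftrightarrow> v = v'"
  by (simp add: inj_map_eq_map inj_lift)

lemma head0_map_lift [simp]: "head0 (map lift l) = lift (head0 l)"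
  by (cases l) auto

lemma one_notin_lift [simp]: "Suc 0 \<notin> lift ` A"
  by auto

lemma zero_in_lift [simp]: "0 \<in> lift ` A \<longleftrightarrow> 0 \<in> A"
  by (force simp: lift_def)

lemma alternating_map_lift [simp]: "alternating (lift a) (map lift l) \<longleftrightarrow> alternating a l"
  by (induction l arbitrary: a) auto

lemma alternating_0_map_lift [simp]: "alternating 0 (map lift l) \<longleftrightarrow> alternating 0 l"
  using alternating_map_lift[of 0 l] by simp

lemma low_pair_map_lift [simp]: "low_pair (lift c) (lift a) (map lift l) \<longleftrightarrow> low_pair c a l"
  by (auto simp: low_pair_def filter_map o_def)

lemma avoids_after_map_lift [simp]: "avoids_after (lift c) (map lift l) \<longleftrightarrow> avoids_after c l"
  by (induction l) auto

lemma avoids_map_lift [simp]: "avoids (map lift l) \<longleftrightarrow> avoids l"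
  by (induction l) auto

lemma ascents_over_map_lift [simp]: "ascents_over (lift x) (map lift l) = ascents_over x l"
  by (induction l) auto

lemma word_2_13_map_lift [simp]: "word_2_13 (map lift l) = word_2_13 l"
  by (induction l) auto

lemma descents_map_lift [simp]: "descents (map lift l) = descents l"
  by (induction l) auto

lemma count_list_map_lift:
  "count_list (map lift l) 0 = count_list l 0"
  "count_list (map lift l) (Suc 0) = 0"
  "count_list (map lift l) (Suc (Suc x)) = count_list l (Suc x)"
  by (induction l) (auto simp: lift_def)

lemma all_nat_012: "(\<forall>x. Q x) \<longleftrightarrow> Q 0 \<and> Q (Suc 0) \<and> (\<forall>x. Q (Suc (Suc x)))" for Q :: "nat \<Rightarrow> bool"
  by (metis not0_implies_Suc)

lemma content_Suc_iff:
  "content (Suc N) h w \<longleftrightarrow> count_list w 0 = h \<and> count_list w (Suc 0) = 1 \<and>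
     (\<forall>x. count_list w (Suc (Suc x)) = (if Suc x \<le> N then 1 else 0))"
  unfolding content_def by (subst all_nat_012) simp

lemma content_iff_0:
  "content N h w \<longleftrightarrow> count_list w 0 = h \<and>
     (\<forall>x. count_list w (Suc x) = (if Suc x \<le> N then 1 else 0))"
  unfolding content_def by (metis not0_implies_Suc nat.distinct(1))

section \<open>Comparing the letters 0 and 1 inside a word\<close>

lemma not_low_pair_1 [simp]: "\<not> low_pair (Suc 0) a l"
  by (auto simp: low_pair_def)

lemma avoids_after_0_1 [simp]: "avoids_after 0 l" "avoids_after (Suc 0) l"
  by (induction l) (auto simp: low_pair_def)

lemma alternating_1: "l \<noteq> [] \<Longrightarrow> head0 l \<noteq> 0 \<Longrightarrow> Suc 0 \<notin> set l \<Longrightarrow>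
    alternating (Suc 0) l \<longleftrightarrow> alternating 0 l"
  by (cases l) auto

lemma alternating_0_head: "alternating 0 l \<Longrightarrow> l \<noteq> [] \<and> 0 < head0 l"
  by (cases l) auto

lemma alternating_after_zero: "alternating a (u @ 0 # s) \<Longrightarrow> alternating 0 s"
  by (induction u arbitrary: a) auto

text \<open>The new zero takes the place of the final border of \<open>u\<close>, and the 1 after it
  makes it a valley.\<close>

lemma alternating_snoc_01 [simp]: "alternating a (u @ [0, Suc 0]) \<longleftrightarrow> alternating a u"
proof (induction u arbitrary: a)
  case (Cons b u)
  then show ?case by (cases u) auto
qed auto

text \<open>The letter before the replaced one exceeds 1, so 0 and 1 are both entered by a descent
  and both need a larger letter next. As \<open>s\<close> has no 1, the same letters are larger than
  0 and larger than 1.\<close>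

lemma alternating_replace:
  assumes "1 < a \<or> u \<noteq> []" "0 \<notin> set u" "Suc 0 \<notin> set u" "Suc 0 \<notin> set s"
  shows "alternating a (u @ Suc 0 # s) \<longleftrightarrow> alternating a (u @ 0 # s)"
  using assms
proof (induction u arbitrary: a)
  case Nil
  then show ?case by (cases s) auto
next
  case (Cons b u)
  then have "1 < b" by auto
  with Cons show ?case by (cases u) auto
qed

text \<open>Neither new letter exceeds a letter of \<open>u\<close>, and the new zero has only one
  letter after it, too few for a low pair.\<close>

lemma avoids_after_snoc_01:
  "0 \<notin> set u \<Longrightarrow> avoids_after c (u @ [0, Suc 0]) \<longleftrightarrow> avoids_after c u"
  by (induction u) (auto simp: low_pair_def)

lemma avoids_snoc_01: "0 \<notin> set u \<Longrightarrow> avoids (u @ [0, Suc 0]) \<longleftrightarrow> avoids u"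
  by (induction u) (auto simp: avoids_after_snoc_01 low_pair_def)

lemma low_pair_one: "Suc 0 \<notin> set s \<Longrightarrow> low_pair c (Suc 0) s \<longleftrightarrow> low_pair c 0 s"
proof -
  assume "Suc 0 \<notin> set s"
  then have *: "Suc 0 < x \<longleftrightarrow> 0 < x" if "x \<in> set s" for x
    using that by (metis Suc_lessI less_Suc_eq_0_disj zero_less_Suc not_less_eq not_less0 Suc_lessD)
  then have "filter (\<lambda>x. Suc 0 < x) s = filter (\<lambda>x. 0 < x) s"
    by (intro filter_cong) auto
  with * show ?thesis by (auto simp: low_pair_def)
qed

text \<open>As the low letter, 0 and 1 lie below the same values \<open>c\<close> and below the same
  letters of \<open>s\<close>; as an upper letter, neither exceeds a letter of
  \<open>u\<close>.\<close>

lemma avoids_after_replace: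
  "0 \<notin> set u \<Longrightarrow> Suc 0 \<notin> set u \<Longrightarrow> Suc 0 \<notin> set s \<Longrightarrow> c \<noteq> Suc 0 \<Longrightarrow>
   avoids_after c (u @ Suc 0 # s) \<longleftrightarrow> avoids_after c (u @ 0 # s)"
proof (induction u)
  case Nil
  then show ?case
    by (cases "c = 0") (auto simp: low_pair_one)
next
  case (Cons a u)
  then have "low_pair c a (u @ Suc 0 # s) \<longleftrightarrow> low_pair c a (u @ 0 # s)"
    by (auto simp: low_pair_def)
  with Cons show ?case by auto
qed

lemma avoids_replace:
  "0 \<notin> set u \<Longrightarrow> Suc 0 \<notin> set u \<Longrightarrow> Suc 0 \<notin> set s \<Longrightarrow>
   avoids (u @ Suc 0 # s) \<longleftrightarrow> avoids (u @ 0 # s)"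
  by (induction u) (auto simp: avoids_after_replace)

lemma ascents_over_replace: "x \<noteq> Suc 0 \<Longrightarrow> ascents_over x (u @ Suc 0 # s) = ascents_over x (u @ 0 # s)"
proof (induction u)
  case (Cons a u)
  then show ?case by (cases u) auto
qed auto

lemma ascents_over_0 [simp]: "ascents_over 0 l = 0"
  by (induction l) auto

text \<open>A 0 is never the middle value of an occurrence, whereas the 1 is one for each ascent
  over it in \<open>s\<close>. The other middle values do not distinguish 0 from 1.\<close>

lemma word_2_13_replace:
  "Suc 0 \<notin> set u \<Longrightarrow>
   word_2_13 (u @ Suc 0 # s) = word_2_13 (u @ 0 # s) + ascents_over (Suc 0) s"
  by (induction u) (auto simp: ascents_over_replace)

lemma ascents_over_snoc_1: "ascents_over x (l @ [Suc 0]) = ascents_over x l"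
proof (induction l)
  case (Cons a u)
  then show ?case by (cases u) auto
qed auto

lemma word_2_13_snoc_1 [simp]: "word_2_13 (l @ [Suc 0]) = word_2_13 l"
  by (induction l) (auto simp: ascents_over_snoc_1)

lemma ascents_over_snoc_0: "ascents_over x (l @ [0]) = ascents_over x l"
proof (induction l)
  case (Cons a u)
  then show ?case by (cases u) auto
qed auto

lemma word_2_13_snoc_0 [simp]: "word_2_13 (l @ [0]) = word_2_13 l"
  by (induction l) (auto simp: ascents_over_snoc_0)

lemma word_2_13_snoc_01 [simp]: "word_2_13 (l @ [0, Suc 0]) = word_2_13 l"
  using word_2_13_snoc_1[of "l @ [0]"] by simp

text \<open>Such an ascent starts at a zero, and \<open>alternating\<close> puts a positive letter,
  hence one above 1, after every zero. This count is the source of the powers of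
  \<open>p\<close>.\<close>

lemma ascents_over_1_zeros:
  "alternating a l \<Longrightarrow> Suc 0 \<notin> set l \<Longrightarrow> ascents_over (Suc 0) l = count_list l 0"
proof (induction l arbitrary: a)
  case (Cons b l)
  then have "ascents_over (Suc 0) l = count_list l 0"
    using Cons.IH[of b] by simp
  with Cons.prems show ?case by (cases l) auto
qed auto

lemma ascents_over_1_no_zero: "0 \<notin> set l \<Longrightarrow> ascents_over (Suc 0) l = 0"
  by (induction l) auto

lemma descents_snoc_01: "0 \<notin> set l \<Longrightarrow> l \<noteq> [] \<Longrightarrow> descents (l @ [0, Suc 0]) = Suc (descents l)"
proof (induction l)
  case (Cons a u)
  then show ?case by (cases u) auto
qed auto

lemma descents_replace:
  "u \<noteq> [] \<Longrightarrow> 0 \<notin> set u \<Longrightarrow> Suc 0 \<notin> set u \<Longrightarrow> head0 s \<noteq> 0 \<Longrightarrow>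
   descents (u @ Suc 0 # s) = descents (u @ 0 # s)"
proof (induction u)
  case (Cons a u)
  then show ?case by (cases u; cases s) auto
qed auto

subsection \<open>Removing the letter one\<close>

lemma content_zero_word: "content 0 h w \<Longrightarrow> set w \<subseteq> {0}"
  by (auto simp: content_def) (metis count_list_0_iff neq0_conv not_less_iff_gr_or_eq le_zero_eq)

lemma words_0 [simp]: "words 0 h = {}"
proof -
  have False if "w \<in> words 0 h" for w
  proof -
    from that have "set w \<subseteq> {0}" "alternating 0 w"
      using content_zero_word by (auto simp: words_def)
    then show False
      using alternating_0_head[of w] by (cases w) auto
  qed
  then show ?thesis by blast
qed

text \<open>The border behaves like a zero, and each of the four insertions undoes a contraction.
  Here the 1 is attached to the left border; \<open>prepend_one_zero\<close> joins the left border
  to the first zero, \<open>append_zero_one\<close> the only zero to the right border, and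
  \<open>first_zero_to_one\<close> restores a 1 that stood alone.\<close>

definition prepend_one :: "nat list \<Rightarrow> nat list" where
  "prepend_one v = Suc 0 # map lift v"

definition prepend_one_zero :: "nat list \<Rightarrow> nat list" where
  "prepend_one_zero v = Suc 0 # 0 # map lift v"

definition append_zero_one :: "nat list \<Rightarrow> nat list" where
  "append_zero_one v = map lift v @ [0, Suc 0]"

definition first_zero_to_one :: "nat list \<Rightarrow> nat list" where
  "first_zero_to_one v = map lift (takeWhile (\<lambda>x. x \<noteq> 0) v) @ Suc 0 #
     map lift (tl (dropWhile (\<lambda>x. x \<noteq> 0) v))"

lemma first_zero_to_one_append [simp]:
  "0 \<notin> set u \<Longrightarrow> first_zero_to_one (u @ 0 # s) = map lift u @ Suc 0 # map lift s"
proof -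
  assume "0 \<notin> set u"
  then have "\<And>x. x \<in> set u \<Longrightarrow> x \<noteq> 0"
    by metis
  then show ?thesis
    by (simp add: first_zero_to_one_def takeWhile_append2 dropWhile_append2)
qed

lemma split_at_zero:
  assumes "content N (Suc h) v"
  obtains u s where "v = u @ 0 # s" "0 \<notin> set u"
proof -
  have "0 \<in> set v"
    using assms by (metis content_iff_0 count_list_0_iff nat.distinct(1))
  then show ?thesis
    using that by (meson split_list_first)
qed

lemma prepend_one_in_words_iff:
  assumes "v \<noteq> []" "head0 v \<noteq> 0"
  shows "prepend_one v \<in> words (Suc N) h \<longleftrightarrow> v \<in> words N h"
  using assms
  by (auto simp: words_def prepend_one_def alternating_1 content_Suc_iff content_iff_0[of N]
      count_list_map_lift)

lemma prepend_one_zero_in_words_iff: "prepend_one_zero v \<in> words (Suc N) (Suc h) \<longleftrightarrow> v \<in> words N h"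
  using alternating_0_head[of v]
  by (auto simp: words_def prepend_one_zero_def content_Suc_iff content_iff_0[of N]
      count_list_map_lift)

lemma append_zero_one_in_words_iff:
  "0 \<notin> set v \<Longrightarrow> append_zero_one v \<in> words (Suc N) (Suc 0) \<longleftrightarrow> v \<in> words N 0"
  by (auto simp: words_def append_zero_one_def content_Suc_iff content_iff_0[of N]
      count_list_map_lift avoids_snoc_01)

lemma first_zero_to_one_in_words_iff:
  assumes "u \<noteq> []" "0 \<notin> set u"
  shows "map lift u @ Suc 0 # map lift s \<in> words (Suc N) h \<longleftrightarrow> u @ 0 # s \<in> words N (Suc h)"
proof -
  have "alternating 0 (map lift u @ Suc 0 # map lift s) \<longleftrightarrow> alternating 0 (map lift (u @ 0 # s))"
    using assms by (simp add: alternating_replace del: alternating_0_map_lift)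
  moreover have "avoids (map lift u @ Suc 0 # map lift s) \<longleftrightarrow> avoids (map lift (u @ 0 # s))"
    using assms by (simp add: avoids_replace del: avoids_map_lift)
  ultimately show ?thesis
    by (auto simp: words_def content_Suc_iff content_iff_0[of N] count_list_map_lift
        simp del: map_append list.map)
qed

text \<open>The first letter of \<open>u\<close> exceeds 1. Together with the zero, the 1 and a
  second positive letter of \<open>s\<close>, in either order, it would violate
  \<open>avoids\<close>.\<close>

lemma zero_before_one:
  assumes "avoids (u @ 0 # s)" "u \<noteq> []" "0 \<notin> set u" "Suc 0 \<in> set s" "Suc 0 \<notin> set u"
  shows "length (filter (\<lambda>x. 0 < x) s) < 2"
proof -
  obtain c u' where u: "u = c # u'"
    using assms by (cases u) auto
  then have c: "1 < c"
    using assms by auto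
  have "avoids_after c (u' @ 0 # s)"
    using assms u by simp
  then have "\<not> low_pair c 0 s"
    using c by (induction u') auto
  then show ?thesis
    using c assms(4) by (auto simp: low_pair_def)
qed

text \<open>The word starts with its only positive letter, which must be 1. Further letters would be
  zeros, but a zero needs a positive letter after it.\<close>

lemma short_alternating_tail:
  assumes "alternating 0 s" "length (filter (\<lambda>x. 0 < x) s) < 2" "Suc 0 \<in> set s"
  shows "s = [Suc 0]"
proof -
  obtain a l where s: "s = a # l" "0 < a"
    using assms by (cases s) auto
  with assms have "filter (\<lambda>x. 0 < x) l = []"
    by simp
  then have "set l \<subseteq> {0}"
    by (auto simp: filter_empty_conv)
  moreover have "l = []"
  proof (rule ccontr)
    assume "l \<noteq> []"
    then obtain b l' where "l = b # l'"
      by (cases l) auto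
    with \<open>set l \<subseteq> {0}\<close> s assms(1) show False
      by (cases l') auto
  qed
  ultimately show ?thesis
    using s assms by auto
qed

text \<open>The position of the 1 decides. If a zero precedes it, the word ends in that zero and the
  1. If it comes first, the next letter is absent, zero or larger. Otherwise only letters above 1
  precede it, and contracting it creates the first zero.\<close>

lemma words_Suc_cases:
  assumes w: "w \<in> words (Suc N) h"
  obtains (single) "N = 0" "h = 0" "w = [Suc 0]"
  | (prepend_one) v where "v \<in> words N h" "w = prepend_one v"
  | (first_zero_to_one) v where "v \<in> words N (Suc h)" "w = first_zero_to_one v"
  | (prepend_one_zero) v h' where "h = Suc h'" "v \<in> words N h'" "w = prepend_one_zero v"
  | (append_zero_one) v where "h = Suc 0" "v \<in> words N 0" "w = append_zero_one v"
proof -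
  have cnt: "count_list w 0 = h" "count_list w (Suc 0) = 1" and alt: "alternating 0 w"
    and av: "avoids w"
    using w by (auto simp: words_def content_Suc_iff)
  have "Suc 0 \<in> set w"
    using cnt by (metis count_list_0_iff zero_neq_one)
  then obtain u s where us: "w = u @ Suc 0 # s" "Suc 0 \<notin> set u"
    by (meson split_list_first)
  then have "count_list s (Suc 0) = 0"
    using cnt by simp
  then have s1: "Suc 0 \<notin> set s"
    by (simp add: count_list_0_iff)
  obtain u' where u': "u = map lift u'"
    using us(2) by (rule ex_map_lift)
  obtain s' where s': "s = map lift s'"
    using s1 by (rule ex_map_lift)
  show thesis
  proof (cases "0 \<in> set u")
    case True
    then obtain x y where xy: "u = x @ 0 # y" "0 \<notin> set x"
      by (meson split_list_first)
    \<comment> \<open>A word cannot begin with 0, which would equal the left border.\<close>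
    have x: "x \<noteq> []"
      using alt us xy by auto
    have "length (filter (\<lambda>x. 0 < x) (y @ Suc 0 # s)) < 2"
      using av us xy x by (intro zero_before_one[of x]) auto
    moreover have "alternating 0 (y @ Suc 0 # s)"
      using alt us xy by (simp add: alternating_after_zero[of 0 x])
    ultimately have "y @ Suc 0 # s = [Suc 0]"
      by (intro short_alternating_tail) auto
    then have w': "w = x @ [0, Suc 0]"
      using us xy by simp
    then have "h = Suc 0"
      using cnt xy by simp
    moreover obtain v where v: "x = map lift v"
      using us(2) xy by (auto intro: ex_map_lift[of x])
    moreover have "v \<in> words N 0"
      using append_zero_one_in_words_iff[of v N] w w' v xy \<open>h = Suc 0\<close> by (simp add: append_zero_one_def)
    ultimately show thesis
      using append_zero_one w' by (simp add: append_zero_one_def)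
  next
    case False
    then have u0: "0 \<notin> set u'"
      using u' by simp
    show thesis
    proof (cases "u = []")
      case True
      then have w': "w = prepend_one s'"
        using us s' by (simp add: prepend_one_def)
      show thesis
      proof (cases s')
        case Nil
        then have w1: "w = [Suc 0]"
          using True us s' by simp
        moreover have "N = 0"
        proof (rule ccontr)
          assume "N \<noteq> 0"
          then have "count_list w (Suc (Suc 0)) = 1"
            using w by (auto simp: words_def content_Suc_iff)
          then show False
            using w1 by simp
        qed
        moreover have "h = 0"
          using cnt w1 by simp
        ultimately show thesis
          using single by simp
      next
        case (Cons a r)
        show thesis
        proof (cases "a = 0")
          case True
          then have w'': "w = prepend_one_zero r"
            using w' Cons by (simp add: prepend_one_def prepend_one_zero_def)
          then obtain h' where "h = Suc h'"
            using cnt by (cases h) (auto simp: prepend_one_zero_def)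
          then show thesis
            using prepend_one_zero w w'' prepend_one_zero_in_words_iff by blast
        next
          case False
          then show thesis
            using Cons w' w prepend_one prepend_one_in_words_iff[of s'] by auto
        qed
      qed
    next
      case False
      then show thesis
        using first_zero_to_one[of "u' @ 0 # s'"] first_zero_to_one_in_words_iff[of u' s' N h] u0 u' s' us w
        by simp
    qed
  qed
qed

lemma prepend_one_in_words: "v \<in> words N h \<Longrightarrow> prepend_one v \<in> words (Suc N) h"
  using alternating_0_head[of v] by (subst prepend_one_in_words_iff) (auto simp: words_def)

lemma first_zero_to_one_decomp:
  assumes "v \<in> words N (Suc h)"
  obtains u s where "v = u @ 0 # s" "0 \<notin> set u" "u \<noteq> []" "s \<noteq> []" "0 < head0 s"
proof -
  obtain u s where v: "v = u @ 0 # s" "0 \<notin> set u"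
    using assms by (auto simp: words_def elim: split_at_zero)
  have "alternating 0 (u @ 0 # s)"
    using assms v by (simp add: words_def)
  then have "u \<noteq> []"
    by auto
  have "alternating 0 s"
    using \<open>alternating 0 (u @ 0 # s)\<close> by (rule alternating_after_zero)
  then show ?thesis
    using that v \<open>u \<noteq> []\<close> alternating_0_head by blast
qed

lemma first_zero_to_one_in_words: "v \<in> words N (Suc h) \<Longrightarrow> first_zero_to_one v \<in> words (Suc N) h"
  by (rule first_zero_to_one_decomp) (auto simp: first_zero_to_one_in_words_iff)

lemma no_zero_words: "v \<in> words N 0 \<Longrightarrow> 0 \<notin> set v"
  by (auto simp: words_def content_iff_0 count_list_0_iff)

lemma append_zero_one_in_words: "v \<in> words N 0 \<Longrightarrow> append_zero_one v \<in> words (Suc N) (Suc 0)"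
  using append_zero_one_in_words_iff no_zero_words by blast

lemma words_1: "words (Suc 0) h = (if h = 0 then {[Suc 0]} else {})"
proof -
  have "[Suc 0] \<in> words (Suc 0) 0"
    by (simp add: words_def content_Suc_iff)
  then show ?thesis
    by (auto elim: words_Suc_cases)
qed

text \<open>\<open>0 < N\<close> sets aside the one-letter word, which starts the recursion and
  comes from none of the insertions.\<close>

lemma words_Suc:
  assumes "0 < N"
  shows "words (Suc N) h = prepend_one ` words N h \<union> first_zero_to_one ` words N (Suc h) \<union>
    ((case h of 0 \<Rightarrow> {} | Suc h' \<Rightarrow> prepend_one_zero ` words N h') \<union>
    (if h = Suc 0 then append_zero_one ` words N 0 else {}))"
    (is "_ = ?R")
proof
  show "words (Suc N) h \<subseteq> ?R"
    using assms by (auto elim!: words_Suc_cases)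
  show "?R \<subseteq> words (Suc N) h"
    by (auto simp: prepend_one_in_words first_zero_to_one_in_words prepend_one_zero_in_words_iff
        append_zero_one_in_words split: nat.splits)
qed

lemma finite_words [simp]: "finite (words N h)"
proof (induction N arbitrary: h)
  case (Suc N)
  show ?case
  proof (cases "N = 0")
    case True
    then show ?thesis
      by (simp add: words_1)
  next
    case False
    then show ?thesis
      using Suc by (auto simp: words_Suc split: nat.split)
  qed
qed simp

section \<open>Injectivity of the insertions and their effect on the statistics\<close>

lemma inj_prepend_one: "inj prepend_one"
  by (auto simp: inj_on_def prepend_one_def)

lemma inj_prepend_one_zero: "inj prepend_one_zero"
  by (auto simp: inj_on_def prepend_one_zero_def)

lemma inj_append_zero_one: "inj append_zero_one"
  by (auto simp: inj_on_def append_zero_one_def)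

lemma inj_on_first_zero_to_one: "inj_on first_zero_to_one (words N (Suc h))"
proof (rule inj_on_inverseI)
  fix v assume "v \<in> words N (Suc h)"
  \<comment> \<open>Truncated subtraction sends 0 and 1 to 0 and undoes \<open>lift\<close>, so this
    map is the contraction.\<close>
  then show "map (\<lambda>x. x - Suc 0) (first_zero_to_one v) = v"
    by (rule first_zero_to_one_decomp) (simp add: o_def)
qed

lemma stats_prepend_one:
  assumes "v \<in> words N h"
  shows "word_2_13 (prepend_one v) = h + word_2_13 v" "word_31_2 (prepend_one v) = word_31_2 v"
    "descents (prepend_one v) = descents v"
proof -
  have v: "alternating 0 v" "count_list v 0 = h"
    using assms by (auto simp: words_def content_iff_0)
  then have "ascents_over (Suc 0) (map lift v) = h"
    by (subst ascents_over_1_zeros[of 0]) (auto simp: count_list_map_lift)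
  then show "word_2_13 (prepend_one v) = h + word_2_13 v" "word_31_2 (prepend_one v) = word_31_2 v"
    by (simp_all add: prepend_one_def rev_map)
  show "descents (prepend_one v) = descents v"
    using alternating_0_head[OF v(1)] by (simp add: prepend_one_def)
qed

lemma stats_prepend_one_zero:
  assumes "v \<in> words N h"
  shows "word_2_13 (prepend_one_zero v) = Suc h + word_2_13 v" "word_31_2 (prepend_one_zero v) = word_31_2 v"
    "descents (prepend_one_zero v) = Suc (descents v)"
proof -
  have v: "alternating 0 v" "count_list v 0 = h"
    using assms by (auto simp: words_def content_iff_0)
  then have "ascents_over (Suc 0) (map lift v) = h"
    by (subst ascents_over_1_zeros[of 0]) (auto simp: count_list_map_lift)
  then show "word_2_13 (prepend_one_zero v) = Suc h + word_2_13 v"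
    "word_31_2 (prepend_one_zero v) = word_31_2 v"
    using alternating_0_head[OF v(1)] by (simp_all add: prepend_one_zero_def rev_map)
  show "descents (prepend_one_zero v) = Suc (descents v)"
    using alternating_0_head[OF v(1)] by (simp add: prepend_one_zero_def)
qed

text \<open>Read backwards, the word starts with 1, 0 and a letter above 1. This is the only ascent
  over the 1, as \<open>v\<close> has no zero; no other insertion raises the exponent of
  \<open>q\<close>.\<close>

lemma stats_append_zero_one:
  assumes "v \<in> words N 0"
  shows "word_2_13 (append_zero_one v) = word_2_13 v"
    "word_31_2 (append_zero_one v) = Suc (word_31_2 v)"
    "descents (append_zero_one v) = Suc (descents v)"
proof -
  have v: "alternating 0 v" "0 \<notin> set v"
    using assms no_zero_words by (auto simp: words_def)
  have "v \<noteq> []"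
    using alternating_0_head[OF v(1)] by simp
  then have "0 < head0 (rev v)"
    using v(2) by (cases v rule: rev_cases) auto
  then show "word_2_13 (append_zero_one v) = word_2_13 v"
    "word_31_2 (append_zero_one v) = Suc (word_31_2 v)"
    "descents (append_zero_one v) = Suc (descents v)"
    using v \<open>v \<noteq> []\<close>
    by (simp_all add: append_zero_one_def rev_map descents_snoc_01 ascents_over_1_no_zero)
qed

text \<open>The new 1 has the remaining \<open>h\<close> zeros to its right and none to its left:
  \<open>h\<close> new occurrences of 2-13 and none of 31-2.\<close>

lemma stats_first_zero_to_one:
  assumes "v \<in> words N (Suc h)"
  shows "word_2_13 (first_zero_to_one v) = h + word_2_13 v"
    "word_31_2 (first_zero_to_one v) = word_31_2 v"
    "descents (first_zero_to_one v) = descents v"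
proof -
  obtain u s where v: "v = u @ 0 # s" "0 \<notin> set u" "u \<noteq> []" "s \<noteq> []" "0 < head0 s"
    using assms by (rule first_zero_to_one_decomp)
  have alt: "alternating 0 (u @ 0 # s)" "count_list (u @ 0 # s) 0 = Suc h"
    using assms v by (auto simp: words_def content_iff_0)
  have "alternating 0 s"
    using alt(1) by (rule alternating_after_zero)
  moreover have "count_list s 0 = h"
    using alt v by (simp add: count_list_0_iff)
  ultimately have "ascents_over (Suc 0) (map lift s) = h"
    by (subst ascents_over_1_zeros[of 0]) (auto simp: count_list_map_lift)
  moreover have "word_2_13 v = word_2_13 (map lift u @ 0 # map lift s)"
    using word_2_13_map_lift[of v] v by simp
  ultimately show "word_2_13 (first_zero_to_one v) = h + word_2_13 v"
    using v by (simp add: word_2_13_replace)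
  have "word_31_2 v = word_2_13 (rev (map lift s) @ 0 # rev (map lift u))"
    using word_2_13_map_lift[of "rev v"] v by (simp add: rev_map)
  then show "word_31_2 (first_zero_to_one v) = word_31_2 v"
    using v by (simp add: word_2_13_replace ascents_over_1_no_zero)
  have "descents v = descents (map lift u @ 0 # map lift s)"
    using descents_map_lift[of v] v by simp
  then show "descents (first_zero_to_one v) = descents v"
    using v by (simp add: descents_replace)
qed

text \<open>A descent is gained only by the two insertions that raise \<open>N + h\<close> by 2. The
  bound makes the truncated subtraction in \<open>weight\<close> exact and limits the range of
  \<open>k\<close> in the final sum.\<close>

lemma descents_bound: "w \<in> words N h \<Longrightarrow> 2 * descents w + 1 \<le> N + h"
proof (induction N arbitrary: h w)
  case (Suc N)
  from Suc.prems show ?case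
  proof (cases rule: words_Suc_cases)
    case (prepend_one v)
    then show ?thesis
      using Suc.IH[of v h] by (simp add: stats_prepend_one)
  next
    case (first_zero_to_one v)
    then show ?thesis
      using Suc.IH[of v "Suc h"] by (simp add: stats_first_zero_to_one)
  next
    case (prepend_one_zero v h')
    then show ?thesis
      using Suc.IH[of v h'] by (simp add: stats_prepend_one_zero)
  next
    case (append_zero_one v)
    then show ?thesis
      using Suc.IH[of v 0] by (simp add: stats_append_zero_one)
  qed auto
qed simp

text \<open>For \<open>m = N + h\<close> the exponent of \<open>1 + t\<close> is the number of
  \<open>prepend_one\<close> insertions that build \<open>w\<close>: these raise it by 1 and the
  others keep it. So every level step carries a factor \<open>1 + t\<close>.\<close>

definition weight :: "'a::comm_ring_1 \<Rightarrow> 'a \<Rightarrow> 'a \<Rightarrow> nat \<Rightarrow> nat list \<Rightarrow> 'a" where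
  "weight p q t m w = p ^ word_2_13 w * q ^ word_31_2 w * t ^ descents w *
     (1 + t) ^ (m - (2 * descents w + 1))"

definition total :: "'a::comm_ring_1 \<Rightarrow> 'a \<Rightarrow> 'a \<Rightarrow> nat \<Rightarrow> nat \<Rightarrow> 'a" where
  "total p q t N h = (\<Sum>w\<in>words N h. weight p q t (N + h) w)"

lemma total_1: "total p q t (Suc 0) h = (if h = 0 then 1 else 0)"
  by (simp add: total_def words_1 weight_def)

lemma total_Suc:
  assumes "0 < N"
  shows "total p q t (Suc N) h =
    p ^ h * (1 + t) * total p q t N h + p ^ h * total p q t N (Suc h) +
    (case h of 0 \<Rightarrow> 0 | Suc h' \<Rightarrow> p ^ h * t * total p q t N h') +
    (if h = Suc 0 then q * t * total p q t N 0 else 0)"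
proof -
  let ?w = "weight p q t (Suc N + h)"
  let ?A = "prepend_one ` words N h" and ?B = "first_zero_to_one ` words N (Suc h)"
  let ?C = "case h of 0 \<Rightarrow> {} | Suc h' \<Rightarrow> prepend_one_zero ` words N h'"
  let ?D = "if h = Suc 0 then append_zero_one ` words N 0 else {}"
  have A: "sum ?w ?A = p ^ h * (1 + t) * total p q t N h"
  proof -
    have "weight p q t (Suc N + h) (prepend_one v) = p ^ h * (1 + t) * weight p q t (N + h) v"
      if "v \<in> words N h" for v
    proof -
      have "Suc N + h - (2 * descents v + 1) = Suc (N + h - (2 * descents v + 1))"
        using descents_bound[OF that] by simp
      then show ?thesis
        unfolding weight_def stats_prepend_one[OF that]
        by (simp only: power_add power_Suc mult_ac)
    qed
    then show ?thesis
      by (subst sum.reindex)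
        (auto simp: total_def sum_distrib_left intro: inj_on_subset[OF inj_prepend_one])
  qed
  have B: "sum ?w ?B = p ^ h * total p q t N (Suc h)"
  proof -
    have "weight p q t (Suc N + h) (first_zero_to_one v) = p ^ h * weight p q t (N + Suc h) v"
      if "v \<in> words N (Suc h)" for v
      using stats_first_zero_to_one[OF that]
      by (simp add: weight_def power_add mult_ac)
    then show ?thesis
      by (subst sum.reindex) (auto simp: total_def sum_distrib_left inj_on_first_zero_to_one)
  qed
  have C: "sum ?w ?C = (case h of 0 \<Rightarrow> 0 | Suc h' \<Rightarrow> p ^ h * t * total p q t N h')"
  proof (cases h)
    case (Suc h')
    have "weight p q t (Suc N + h) (prepend_one_zero v) = p ^ h * t * weight p q t (N + h') v"
      if "v \<in> words N h'" for v
      using stats_prepend_one_zero[OF that] Suc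
      by (simp add: weight_def power_add mult_ac)
    then show ?thesis
      unfolding Suc nat.case
      by (subst sum.reindex)
        (auto simp: total_def sum_distrib_left Suc intro: inj_on_subset[OF inj_prepend_one_zero])
  qed simp
  have D: "sum ?w ?D = (if h = Suc 0 then q * t * total p q t N 0 else 0)"
  proof (cases "h = Suc 0")
    case True
    have "weight p q t (Suc N + h) (append_zero_one v) = q * t * weight p q t (N + 0) v"
      if "v \<in> words N 0" for v
      using stats_append_zero_one[OF that] True
      by (simp add: weight_def power_add mult_ac)
    then show ?thesis
      unfolding if_P[OF True]
      by (subst sum.reindex)
        (auto simp: total_def sum_distrib_left intro: inj_on_subset[OF inj_append_zero_one])
  qed simp
  \<comment> \<open>The four images are separated by three features: whether the word begins with 1,
    whether a zero comes second, and whether it ends in 1.\<close>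
  have shape: "hd w = Suc 0" "0 < head0 (tl w)" if "w \<in> ?A" for w
    using that alternating_0_head by (fastforce simp: prepend_one_def words_def)+
  have shape': "hd w = Suc 0" "head0 (tl w) = 0" if "w \<in> ?C" for w
    using that by (auto simp: prepend_one_zero_def split: nat.splits)
  have raised: "hd w \<noteq> Suc 0" "last w \<noteq> Suc 0" if "w \<in> ?B" for w
  proof -
    from that obtain v where v: "v \<in> words N (Suc h)" and w: "w = first_zero_to_one v"
      by (rule imageE)
    from v obtain u s where "v = u @ 0 # s" "0 \<notin> set u" "u \<noteq> []" "s \<noteq> []"
      by (rule first_zero_to_one_decomp)
    with w show "hd w \<noteq> Suc 0" "last w \<noteq> Suc 0"
      by (simp_all add: hd_append last_map hd_map)
  qed
  have closed: "hd w \<noteq> Suc 0" "last w = Suc 0" if "w \<in> ?D" for w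
  proof -
    obtain v where v: "v \<in> words N 0" and w: "w = append_zero_one v"
      using \<open>w \<in> ?D\<close> by (auto split: if_splits)
    from v have "v \<noteq> []"
      using alternating_0_head by (auto simp: words_def)
    with w show "hd w \<noteq> Suc 0" "last w = Suc 0"
      by (simp_all add: append_zero_one_def hd_append hd_map)
  qed
  have disj: "X \<inter> Y = {}" if "\<And>w. w \<in> X \<Longrightarrow> f w = c" "\<And>w. w \<in> Y \<Longrightarrow> f w \<noteq> c"
    for X Y :: "nat list set" and f and c :: nat
    using that by blast
  have "?A \<inter> ?B = {}"
    by (rule disj[of _ hd "Suc 0"]) (fact shape(1), fact raised(1))
  moreover have "?C \<inter> ?D = {}"
    by (rule disj[of _ hd "Suc 0"]) (fact shape'(1), fact closed(1))
  moreover have "(?A \<union> ?B) \<inter> (?C \<union> ?D) = {}"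
  proof -
    have "?C \<inter> ?A = {}"
      by (rule disj[of _ "\<lambda>w. head0 (tl w)" 0]) (fact shape'(2), simp only: shape(2) neq0_conv)
    moreover have "?A \<inter> ?D = {}"
      by (rule disj[of _ hd "Suc 0"]) (fact shape(1), fact closed(1))
    moreover have "?C \<inter> ?B = {}"
      by (rule disj[of _ hd "Suc 0"]) (fact shape'(1), fact raised(1))
    moreover have "?D \<inter> ?B = {}"
      by (rule disj[of _ last "Suc 0"]) (fact closed(2), fact raised(2))
    ultimately show ?thesis
      by (simp only: Int_Un_distrib Int_Un_distrib2 Int_commute Un_empty)
  qed
  moreover have "finite ?A" "finite ?B"
    by simp_all
  moreover have "finite ?C" "finite ?D"
    by (auto split: nat.splits)
  ultimately have "total p q t (Suc N) h = sum ?w ?A + sum ?w ?B + (sum ?w ?C + sum ?w ?D)"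
    unfolding total_def words_Suc[OF assms] by (simp only: sum.union_disjoint finite_Un)
  then show ?thesis
    unfolding A B C D by (simp only: add.assoc)
qed

subsection \<open>The continued fraction\<close>

text \<open>
  \<open>g h\<close> is the generating function of the paths from height \<open>0\<close> to height \<open>h\<close>. Decomposing at the
  last visit to height \<open>h - 1\<close> gives \<open>g h = d h z J g (h - 1)\<close>, where \<open>J\<close> is the tail of the fraction
  at level \<open>h\<close>; with the \<open>N\<close>-th convergent for \<open>J\<close> it holds modulo \<open>z ^ N\<close>, by induction on \<open>N\<close>.
\<close>

lemma J_fraction_transfer:
  fixes g :: "nat \<Rightarrow> 'a::comm_ring_1 fps"
  assumes "g 0 = 1 + fps_X * (fps_const (b 0) * g 0 + fps_const (u 0) * g (Suc 0))"
    and "\<And>h. g (Suc h) = fps_X * (fps_const (b (Suc h)) * g (Suc h) +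
           fps_const (u (Suc h)) * g (Suc (Suc h)) + fps_const (d (Suc h)) * g h)"
    and "\<And>h. c (Suc h) = u h * d (Suc h)"
  shows "J_fraction b c = g 0"
proof -
  \<comment> \<open>\<open>r h\<close> accounts for the paths that are empty or have just stepped up
    to height \<open>h\<close>; the tail of the fraction then describes what stays at height at
    least \<open>h\<close>.\<close>
  define r where "r h = (case h of 0 \<Rightarrow> 1 | Suc h' \<Rightarrow> fps_X * fps_const (d h) * g h')" for h
  have g: "g h = r h + fps_X * (fps_const (b h) * g h + fps_const (u h) * g (Suc h))" for h
  proof (cases h)
    case 0
    then show ?thesis using assms(1) by (simp add: r_def)
  next
    case (Suc h')
    then show ?thesis by (subst Suc, subst assms(2)) (simp add: r_def algebra_simps)
  qed
  have approx: "fps_X ^ N dvd g h - J_convergent b c N h * r h" for N h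
  proof (induction N arbitrary: h)
    case (Suc N)
    let ?J = "J_convergent b c"
    let ?den = "1 - fps_const (b h) * fps_X - fps_const (c (Suc h)) * fps_X ^ 2 * ?J N (Suc h)"
    have den: "?den * ?J (Suc N) h = 1"
      by (rule J_convergent_Suc_mult)
    obtain e where e: "g (Suc h) - ?J N (Suc h) * r (Suc h) = fps_X ^ N * e"
      using Suc by (metis dvdE)
    \<comment> \<open>Since \<open>c (Suc h) = u h * d (Suc h)\<close>, the last term of the
      denominator times \<open>g h\<close> becomes a multiple of \<open>r (Suc h)\<close>. The
      induction hypothesis at \<open>Suc h\<close> then applies, and the factor \<open>fps_X\<close>
      in front gains one order.\<close>
    have "?den * g h = r h + fps_X * fps_const (u h) * (g (Suc h) - ?J N (Suc h) * r (Suc h))"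
    proof -
      have "?den * g h = (g h - fps_X * (fps_const (b h) * g h))
          - fps_const (u h * d (Suc h)) * fps_X ^ 2 * ?J N (Suc h) * g h"
        by (simp add: assms(3) algebra_simps)
      also have "g h - fps_X * (fps_const (b h) * g h) = r h + fps_X * fps_const (u h) * g (Suc h)"
        using g[of h] by (simp add: algebra_simps)
      finally show ?thesis
        by (simp add: r_def power2_eq_square algebra_simps flip: fps_const_mult)
    qed
    then have "?J (Suc N) h * (?den * g h) =
        ?J (Suc N) h * r h + fps_X ^ Suc N * (?J (Suc N) h * fps_const (u h) * e)"
      unfolding e by (simp only: distrib_left mult_ac power_Suc)
    moreover have "?J (Suc N) h * (?den * g h) = g h"
      using den by (metis mult.assoc mult.commute mult_1)
    ultimately have "g h - ?J (Suc N) h * r h =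
        fps_X ^ Suc N * (?J (Suc N) h * fps_const (u h) * e)"
      by (metis add_diff_cancel_left')
    then show ?case
      by (metis dvd_triv_left)
  qed simp
  show ?thesis
  proof (rule fps_ext)
    fix n
    \<comment> \<open>Agreement modulo \<open>fps_X ^ Suc n\<close> is what fixes coefficient
      \<open>n\<close>.\<close>
    obtain e where "g 0 - J_convergent b c (Suc n) 0 * r 0 = fps_X ^ Suc n * e"
      using approx by (metis dvdE)
    then have "fps_nth (g 0 - J_convergent b c (Suc n) 0) n = 0"
      by (simp add: r_def fps_X_power_mult_nth del: J_convergent.simps power_Suc)
    then show "fps_nth (J_fraction b c) n = fps_nth (g 0) n"
      by (simp add: J_fraction_nth[of n "Suc n"] del: J_convergent.simps)
  qed
qed

text \<open>The one-letter word is the empty path, hence the shift to \<open>Suc n\<close>. A step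
  down to height \<open>h\<close> weighs \<open>p ^ h\<close>, a step up to it
  \<open>p ^ h * t\<close>, with \<open>q * t\<close> added for \<open>h = 1\<close>. The products
  of opposite steps are the partial numerators, as
  \<open>h + (h + 1) = 2 * (h + 1) - 1\<close>.\<close>

lemma calB_eq_total: "calB n p q t = total p q t (Suc n) 0"
proof -
  let ?b = "\<lambda>h. p ^ h * (1 + t)"
  let ?c = "\<lambda>h. if h = 1 then (p + q) * t else p ^ (2 * h - 1) * t"
  let ?d = "\<lambda>h. if h = 1 then (p + q) * t else p ^ h * t"
  let ?g = "\<lambda>h. Abs_fps (\<lambda>n. total p q t (Suc n) h)"
  have "J_fraction ?b ?c = ?g 0"
  proof (rule J_fraction_transfer[where u = "\<lambda>h. p ^ h" and d = ?d])
    show "?g 0 = 1 + fps_X * (fps_const (?b 0) * ?g 0 + fps_const (p ^ 0) * ?g (Suc 0))"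
    proof (rule fps_ext)
      fix n
      show "fps_nth (?g 0) n =
          fps_nth (1 + fps_X * (fps_const (?b 0) * ?g 0 + fps_const (p ^ 0) * ?g (Suc 0))) n"
        by (cases n) (simp_all add: total_1 total_Suc[of "Suc _"])
    qed
    show "?g (Suc h) = fps_X * (fps_const (?b (Suc h)) * ?g (Suc h) +
        fps_const (p ^ Suc h) * ?g (Suc (Suc h)) + fps_const (?d (Suc h)) * ?g h)" for h
    proof (rule fps_ext)
      fix n
      show "fps_nth (?g (Suc h)) n = fps_nth (fps_X * (fps_const (?b (Suc h)) * ?g (Suc h) +
        fps_const (p ^ Suc h) * ?g (Suc (Suc h)) + fps_const (?d (Suc h)) * ?g h)) n"
        by (cases n) (auto simp: total_1 total_Suc[of "Suc _"] algebra_simps)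
    qed
    show "?c (Suc h) = p ^ h * ?d (Suc h)" for h
      by (auto simp add: mult_2_right power_add mult_ac)
  qed
  then show ?thesis
    by (simp add: calB_def)
qed

subsection \<open>Permutations as words\<close>

definition one_line :: "nat \<Rightarrow> (nat \<Rightarrow> nat) \<Rightarrow> nat list" where
  "one_line m \<sigma> = map \<sigma> [1..<Suc m]"

lemma length_one_line [simp]: "length (one_line m \<sigma>) = m"
  by (simp add: one_line_def)

lemma nth_one_line [simp]: "i < m \<Longrightarrow> one_line m \<sigma> ! i = \<sigma> (Suc i)"
  by (simp add: one_line_def del: upt_Suc)

section \<open>The statistics in terms of positions\<close>

lemma head0_eq_nth: "l \<noteq> [] \<Longrightarrow> head0 l = l ! 0"
  by (cases l) auto

text \<open>Serves inductions over \<open>a # l\<close>: index 0 belongs to the new head, and the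
  other indices are those of \<open>l\<close> moved by one.\<close>

lemma card_Suc_shift:
  assumes "finite {j. Q j}"
  shows "card {j. Q j} = of_bool (Q 0) + card {j. Q (Suc j)}"
proof -
  have *: "{j. Q j} = (if Q 0 then {0} else {}) \<union> Suc ` {j. Q (Suc j)}"
    by (auto simp: image_iff) (metis not0_implies_Suc)+
  then have "finite (Suc ` {j. Q (Suc j)})"
    using assms by (metis finite_Un)
  then show ?thesis
    by (subst *, subst card_Un_disjoint) (auto simp: card_image)
qed

lemma ascents_over_conv_card:
  "ascents_over x l = card {j. Suc j < length l \<and> l ! j < x \<and> x < l ! Suc j}"
proof (induction l)
  case (Cons a l)
  have "ascents_over x (a # l) = of_bool (l \<noteq> [] \<and> a < x \<and> x < l ! 0) + ascents_over x l"
    by (cases l) auto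
  then show ?case
    by (subst card_Suc_shift) (auto simp: Cons)
qed simp

lemma word_2_13_conv_card:
  "word_2_13 l =
    (\<Sum>i<length l. card {j. i < j \<and> Suc j < length l \<and> l ! j < l ! i \<and> l ! i < l ! Suc j})"
proof (induction l)
  case (Cons a l)
  let ?S = "\<lambda>l i. {j. i < j \<and> Suc j < length l \<and> l ! j < l ! i \<and> l ! i < l ! Suc j}"
  have shift: "card (?S (a # l) (Suc i)) = card (?S l i)" for i
    by (subst card_Suc_shift) simp_all
  have first: "card (?S (a # l) 0) = ascents_over a l"
    by (subst card_Suc_shift) (simp_all add: ascents_over_conv_card)
  have "(\<Sum>i<length (a # l). card (?S (a # l) i)) =
      card (?S (a # l) 0) + (\<Sum>i<length l. card (?S (a # l) (Suc i)))"
    by (simp only: list.size sum.lessThan_Suc_shift add_0_right add_Suc_right)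
  then show ?case
    by (simp only: shift first Cons word_2_13.simps)
qed simp

lemma descents_conv_card: "descents l = card {j. Suc j < length l \<and> l ! Suc j < l ! j}"
proof (induction l)
  case (Cons a l)
  show ?case
    by (subst card_Suc_shift) (auto simp: Cons head0_eq_nth)
qed simp

lemma des_eq: "des m \<sigma> = descents (one_line m \<sigma>)"
proof -
  have "{i. 1 \<le> i \<and> i < m \<and> \<sigma> (i + 1) < \<sigma> i} = Suc ` {j. Suc j < m \<and> \<sigma> (Suc (Suc j)) < \<sigma> (Suc j)}"
    by (auto simp: image_iff Suc_le_eq gr0_conv_Suc)
  also have "card \<dots> = card {j. Suc j < m \<and> \<sigma> (Suc (Suc j)) < \<sigma> (Suc j)}"
    by (simp add: card_image)
  also have "{j. Suc j < m \<and> \<sigma> (Suc (Suc j)) < \<sigma> (Suc j)} =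
      {j. Suc j < length (one_line m \<sigma>) \<and> one_line m \<sigma> ! Suc j < one_line m \<sigma> ! j}"
    by auto
  finally show ?thesis
    by (simp only: des_def descents_conv_card)
qed

lemma stat_2_13_eq: "stat_2_13 m \<sigma> = word_2_13 (one_line m \<sigma>)"
proof -
  let ?w = "one_line m \<sigma>"
  have "card {j. Suc i < j \<and> j < m \<and> \<sigma> j < \<sigma> (Suc i) \<and> \<sigma> (Suc i) < \<sigma> (j + 1)} =
      card {j. i < j \<and> Suc j < length ?w \<and> ?w ! j < ?w ! i \<and> ?w ! i < ?w ! Suc j}"
    if "i < m" for i
    using that by (subst card_Suc_shift) (auto intro!: arg_cong[of _ _ card])
  then show ?thesis
    unfolding stat_2_13_def word_2_13_conv_card
    by (simp add: sum.atLeast1_atMost_eq)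
qed

text \<open>Index \<open>i\<close> of the reversed word is position \<open>m - i\<close> of the
  permutation, so the same reflection handles the outer sum and the inner count.\<close>

lemma stat_31_2_eq: "stat_31_2 m \<sigma> = word_31_2 (one_line m \<sigma>)"
proof -
  let ?w = "rev (one_line m \<sigma>)"
  have "word_2_13 ?w = (\<Sum>i<m. card {j. i < j \<and> Suc j < m \<and> ?w ! j < ?w ! i \<and> ?w ! i < ?w ! Suc j})"
    by (simp add: word_2_13_conv_card)
  also have "\<dots> = stat_31_2 m \<sigma>"
    unfolding stat_31_2_def
  proof (rule sum.reindex_bij_witness[of _ "\<lambda>i. m - i" "\<lambda>i. m - i"])
    fix i assume "i \<in> {..<m}"
    then have i: "i < m" by simp
    have "bij_betw (\<lambda>j. m - j)
      {j. 1 < j \<and> j < m - i \<and> \<sigma> j < \<sigma> (m - i) \<and> \<sigma> (m - i) < \<sigma> (j - 1)}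
      {j. i < j \<and> Suc j < m \<and> ?w ! j < ?w ! i \<and> ?w ! i < ?w ! Suc j}"
      using i
      by (intro bij_betw_byWitness[of _ "\<lambda>j. m - j"])
        (auto simp: rev_nth Suc_diff_Suc diff_less_mono2)
    then show "card {j. 1 < j \<and> j < m - i \<and> \<sigma> j < \<sigma> (m - i) \<and> \<sigma> (m - i) < \<sigma> (j - 1)} =
      card {j. i < j \<and> Suc j < m \<and> ?w ! j < ?w ! i \<and> ?w ! i < ?w ! Suc j}"
      by (rule bij_betw_same_card)
  qed auto
  finally show ?thesis ..
qed

section \<open>Double descents and patterns in terms of positions\<close>

lemma alternating_conv_nth:
  "alternating a l \<longleftrightarrow> (l = [] \<longrightarrow> a \<noteq> 0) \<and>
     (\<forall>i<length l. (a # l) ! i \<noteq> l ! i \<and> (l ! i < (a # l) ! i \<longrightarrow> l ! i < (l @ [0]) ! Suc i))"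
proof (induction l arbitrary: a)
  case (Cons b l)
  have "head0 l = (l @ [0]) ! 0"
    by (cases l) auto
  then show ?case
    by (auto simp: Cons All_less_Suc2)
qed simp

text \<open>An increasing tuple of positions either starts at \<open>x\<close> or lies in
  \<open>l\<close>. The three lemmas of this kind unfold \<open>low_pair\<close>,
  \<open>avoids_after\<close> and \<open>avoids\<close> one letter of the quadruple at a
  time.\<close>

lemma ex_nth2_Cons:
  "(\<exists>i j. i < j \<and> j < length (x # l) \<and> R ((x # l) ! i) ((x # l) ! j)) \<longleftrightarrow>
   (\<exists>j<length l. R x (l ! j)) \<or> (\<exists>i j. i < j \<and> j < length l \<and> R (l ! i) (l ! j))"
    (is "?L \<longleftrightarrow> ?R")
proof
  assume ?L
  then obtain i j where "i < j" "j < length (x # l)" "R ((x # l) ! i) ((x # l) ! j)"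
    by blast
  then show ?R
    by (cases i; cases j) auto
next
  assume ?R
  then show ?L
  proof
    assume "\<exists>j<length l. R x (l ! j)"
    then obtain j where "j < length l" "R x (l ! j)"
      by blast
    then show ?L
      by (intro exI[of _ 0] exI[of _ "Suc j"]) simp
  next
    assume "\<exists>i j. i < j \<and> j < length l \<and> R (l ! i) (l ! j)"
    then obtain i j where "i < j" "j < length l" "R (l ! i) (l ! j)"
      by blast
    then show ?L
      by (intro exI[of _ "Suc i"] exI[of _ "Suc j"]) simp
  qed
qed

lemma ex_nth3_Cons:
  "(\<exists>i j k. i < j \<and> j < k \<and> k < length (x # l) \<and> R ((x # l) ! i) ((x # l) ! j) ((x # l) ! k)) \<longleftrightarrow>
   (\<exists>i j. i < j \<and> j < length l \<and> R x (l ! i) (l ! j)) \<or>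
   (\<exists>i j k. i < j \<and> j < k \<and> k < length l \<and> R (l ! i) (l ! j) (l ! k))"
    (is "?L \<longleftrightarrow> ?R1 \<or> ?R2")
proof
  assume ?L
  then obtain i j k where "i < j" "j < k" "k < length (x # l)"
      "R ((x # l) ! i) ((x # l) ! j) ((x # l) ! k)"
    by blast
  then show "?R1 \<or> ?R2"
    by (cases i; cases j; cases k) auto
next
  assume "?R1 \<or> ?R2"
  then show ?L
  proof
    assume ?R1
    then obtain i j where "i < j" "j < length l" "R x (l ! i) (l ! j)"
      by blast
    then show ?L
      by (intro exI[of _ 0] exI[of _ "Suc i"] exI[of _ "Suc j"]) simp
  next
    assume ?R2
    then obtain i j k where "i < j" "j < k" "k < length l" "R (l ! i) (l ! j) (l ! k)"
      by blast
    then show ?L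
      by (intro exI[of _ "Suc i"] exI[of _ "Suc j"] exI[of _ "Suc k"]) simp
  qed
qed

lemma ex_nth4_Cons:
  "(\<exists>i j k m. i < j \<and> j < k \<and> k < m \<and> m < length (x # l) \<and>
      R ((x # l) ! i) ((x # l) ! j) ((x # l) ! k) ((x # l) ! m)) \<longleftrightarrow>
   (\<exists>i j k. i < j \<and> j < k \<and> k < length l \<and> R x (l ! i) (l ! j) (l ! k)) \<or>
   (\<exists>i j k m. i < j \<and> j < k \<and> k < m \<and> m < length l \<and> R (l ! i) (l ! j) (l ! k) (l ! m))"
    (is "?L \<longleftrightarrow> ?R1 \<or> ?R2")
proof
  assume ?L
  then obtain i j k m where "i < j" "j < k" "k < m" "m < length (x # l)"
      "R ((x # l) ! i) ((x # l) ! j) ((x # l) ! k) ((x # l) ! m)"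
    by blast
  then show "?R1 \<or> ?R2"
    by (cases i; cases j; cases k; cases m) auto
next
  assume "?R1 \<or> ?R2"
  then show ?L
  proof
    assume ?R1
    then obtain i j k where "i < j" "j < k" "k < length l" "R x (l ! i) (l ! j) (l ! k)"
      by blast
    then show ?L
      by (intro exI[of _ 0] exI[of _ "Suc i"] exI[of _ "Suc j"] exI[of _ "Suc k"]) simp
  next
    assume ?R2
    then obtain i j k m where "i < j" "j < k" "k < m" "m < length l"
        "R (l ! i) (l ! j) (l ! k) (l ! m)"
      by blast
    then show ?L
      by (intro exI[of _ "Suc i"] exI[of _ "Suc j"] exI[of _ "Suc k"] exI[of _ "Suc m"]) simp
  qed
qed

lemma low_pair_conv_nth:
  "low_pair c a l \<longleftrightarrow> (\<exists>i j. i < j \<and> j < length l \<and>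
     (a < l ! i \<and> a < l ! j \<and> (l ! i < c \<or> l ! j < c)))"
proof (induction l)
  case Nil
  then show ?case by (simp add: low_pair_def)
next
  case (Cons x l)
  have ge1: "Suc 0 \<le> length (filter P l) \<longleftrightarrow> (\<exists>y\<in>set l. P y)" for P
    by (induction l) auto
  have "low_pair c a (x # l) \<longleftrightarrow>
      (\<exists>y\<in>set l. a < x \<and> a < y \<and> (x < c \<or> y < c)) \<or> low_pair c a l"
    by (auto simp: low_pair_def ge1)
  also have "\<dots> \<longleftrightarrow> (\<exists>j<length l. a < x \<and> a < l ! j \<and> (x < c \<or> l ! j < c)) \<or> low_pair c a l"
    by (simp add: Bex_def in_set_conv_nth) blast
  finally show ?case
    unfolding Cons ex_nth2_Cons[where R = "\<lambda>x y. a < x \<and> a < y \<and> (x < c \<or> y < c)"] .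
qed

lemma avoids_after_conv_nth:
  "avoids_after c l \<longleftrightarrow> \<not> (\<exists>i j k. i < j \<and> j < k \<and> k < length l \<and>
     (l ! i < c \<and> l ! i < l ! j \<and> l ! i < l ! k \<and> (l ! j < c \<or> l ! k < c)))"
proof (induction l)
  case (Cons a l)
  show ?case
    unfolding ex_nth3_Cons[where R = "\<lambda>a x y. a < c \<and> a < x \<and> a < y \<and> (x < c \<or> y < c)"]
      avoids_after.simps low_pair_conv_nth Cons
    by blast
qed simp

lemma avoids_conv_nth:
  "avoids w \<longleftrightarrow> \<not> (\<exists>i j k l. i < j \<and> j < k \<and> k < l \<and> l < length w \<and>
     (w ! j < w ! i \<and> w ! j < w ! k \<and> w ! j < w ! l \<and> (w ! k < w ! i \<or> w ! l < w ! i)))"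
proof (induction w)
  case (Cons c w)
  show ?case
    unfolding
      ex_nth4_Cons[where R = "\<lambda>c a x y. a < c \<and> a < x \<and> a < y \<and> (x < c \<or> y < c)"]
      avoids.simps avoids_after_conv_nth Cons
    by blast
qed simp

text \<open>A strictly increasing \<open>f\<close> on four points is an increasing quadruple of
  positions; indexing the list \<open>[i, j, k, l]\<close> gives \<open>f\<close> back.\<close>

lemma contains_pattern_4:
  "contains_pattern m \<sigma> [a, b, c, d] \<longleftrightarrow>
    (\<exists>i j k l. 1 \<le> i \<and> i < j \<and> j < k \<and> k < l \<and> l \<le> m \<and>
      (\<forall>x<4. \<forall>y<4. [\<sigma> i, \<sigma> j, \<sigma> k, \<sigma> l] ! x < [\<sigma> i, \<sigma> j, \<sigma> k, \<sigma> l] ! y \<longleftrightarrow>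
        [a, b, c, d] ! x < [a, b, c, d] ! y))"
    (is "_ \<longleftrightarrow> ?R")
proof
  have len: "length [a, b, c, d] = 4"
    by simp
  assume "contains_pattern m \<sigma> [a, b, c, d]"
  then obtain f where f: "strict_mono_on {..<4} f" "f ` {..<4} \<subseteq> {1..m}"
    "\<forall>x<4. \<forall>y<4. \<sigma> (f x) < \<sigma> (f y) \<longleftrightarrow> [a, b, c, d] ! x < [a, b, c, d] ! y"
    unfolding contains_pattern_def len by blast
  have nth: "[\<sigma> (f 0), \<sigma> (f 1), \<sigma> (f 2), \<sigma> (f 3)] ! x = \<sigma> (f x)" if "x < 4" for x
  proof -
    have "x = 0 \<or> x = 1 \<or> x = 2 \<or> x = 3"
      using that by linarith
    then show ?thesis
      by (elim disjE) simp_all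
  qed
  have "f 0 < f 1" "f 1 < f 2" "f 2 < f 3"
    using f(1) by (auto simp: strict_mono_on_def)
  moreover have "1 \<le> f 0" "f 3 \<le> m"
    using f(2) by (auto simp: image_subset_iff)
  moreover have "\<forall>x<4. \<forall>y<4. [\<sigma> (f 0), \<sigma> (f 1), \<sigma> (f 2), \<sigma> (f 3)] ! x <
      [\<sigma> (f 0), \<sigma> (f 1), \<sigma> (f 2), \<sigma> (f 3)] ! y \<longleftrightarrow> [a, b, c, d] ! x < [a, b, c, d] ! y"
  proof (intro allI impI)
    fix x y :: nat assume xy: "x < 4" "y < 4"
    show "[\<sigma> (f 0), \<sigma> (f 1), \<sigma> (f 2), \<sigma> (f 3)] ! x <
        [\<sigma> (f 0), \<sigma> (f 1), \<sigma> (f 2), \<sigma> (f 3)] ! y \<longleftrightarrow> [a, b, c, d] ! x < [a, b, c, d] ! y"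
      unfolding nth[OF xy(1)] nth[OF xy(2)] using f(3) xy by blast
  qed
  ultimately show ?R
    by blast
next
  have len: "length [a, b, c, d] = 4"
    by simp
  assume ?R
  then obtain i j k l where ijkl: "1 \<le> i" "i < j" "j < k" "k < l" "l \<le> m"
    "\<forall>x<4. \<forall>y<4. [\<sigma> i, \<sigma> j, \<sigma> k, \<sigma> l] ! x < [\<sigma> i, \<sigma> j, \<sigma> k, \<sigma> l] ! y \<longleftrightarrow>
        [a, b, c, d] ! x < [a, b, c, d] ! y"
    by blast
  let ?f = "\<lambda>x. [i, j, k, l] ! x"
  have nth: "[\<sigma> i, \<sigma> j, \<sigma> k, \<sigma> l] ! x = \<sigma> (?f x)" if "x < 4" for x
    using nth_map[of x "[i, j, k, l]" \<sigma>] that by (simp only: list.map list.size)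
  have "sorted_wrt (<) [i, j, k, l]"
    using ijkl by simp
  then have "strict_mono_on {..<4} ?f"
    by (intro strict_mono_onI sorted_wrt_nth_less[of "(<)" "[i, j, k, l]"]) simp_all
  moreover have "?f ` {..<4} \<subseteq> {1..m}"
  proof -
    have "?f x \<in> set [i, j, k, l]" if "x < 4" for x
      using that by (intro nth_mem) simp
    moreover have "set [i, j, k, l] \<subseteq> {1..m}"
      using ijkl by auto
    ultimately show ?thesis
      by blast
  qed
  moreover have "\<forall>x<4. \<forall>y<4. \<sigma> (?f x) < \<sigma> (?f y) \<longleftrightarrow> [a, b, c, d] ! x < [a, b, c, d] ! y"
  proof (intro allI impI)
    fix x y :: nat assume xy: "x < 4" "y < 4"
    show "\<sigma> (?f x) < \<sigma> (?f y) \<longleftrightarrow> [a, b, c, d] ! x < [a, b, c, d] ! y"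
      unfolding nth[OF xy(1), symmetric] nth[OF xy(2), symmetric] using ijkl(6) xy by blast
  qed
  ultimately show "contains_pattern m \<sigma> [a, b, c, d]"
    unfolding contains_pattern_def len by blast
qed

lemma all_less_4: "(\<forall>a<4. Q a) \<longleftrightarrow> Q 0 \<and> Q 1 \<and> Q 2 \<and> Q (3::nat)"
proof -
  have "a < 4 \<longleftrightarrow> a = 0 \<or> a = 1 \<or> a = 2 \<or> a = 3" for a :: nat
    by linarith
  then show ?thesis
    by auto
qed

text \<open>With \<open>b\<close> smallest there are six orders of \<open>a\<close>,
  \<open>c\<close>, \<open>d\<close>. The last condition excludes the two in which \<open>a\<close>
  is least, and the other four are the patterns.\<close>

lemma bad_quadruple_iff:
  fixes a b c d :: nat
  assumes "a \<noteq> c" "a \<noteq> d" "c \<noteq> d"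
  shows "b < a \<and> b < c \<and> b < d \<and> (c < a \<or> d < a) \<longleftrightarrow>
    (\<exists>\<tau>\<in>{[3,1,2,4], [4,1,2,3], [3,1,4,2], [4,1,3,2]}. \<forall>x<4. \<forall>y<4.
      [a, b, c, d] ! x < [a, b, c, d] ! y \<longleftrightarrow> (\<tau> :: nat list) ! x < \<tau> ! y)"
    (is "?L \<longleftrightarrow> (\<exists>\<tau>\<in>?T. ?P \<tau>)")
proof
  assume L: ?L
  consider "d < a" "c < d" | "a < d" "c < a" | "c < a" "d < c" | "a < c" "d < a"
    using L assms by linarith
  then show "\<exists>\<tau>\<in>?T. ?P \<tau>"
  proof cases
    case 1
    then have "?P [4,1,2,3]"
      using L unfolding all_less_4 by simp
    then show ?thesis by blast
  next
    case 2
    then have "?P [3,1,2,4]"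
      using L unfolding all_less_4 by simp
    then show ?thesis by blast
  next
    case 3
    then have "?P [4,1,3,2]"
      using L unfolding all_less_4 by simp
    then show ?thesis by blast
  next
    case 4
    then have "?P [3,1,4,2]"
      using L unfolding all_less_4 by simp
    then show ?thesis by blast
  qed
next
  assume "\<exists>\<tau>\<in>?T. ?P \<tau>"
  then obtain \<tau> where \<tau>: "\<tau> \<in> ?T" "?P \<tau>"
    by blast
  have "b < a \<longleftrightarrow> \<tau> ! 1 < \<tau> ! 0" "b < c \<longleftrightarrow> \<tau> ! 1 < \<tau> ! 2" "b < d \<longleftrightarrow> \<tau> ! 1 < \<tau> ! 3"
    "c < a \<longleftrightarrow> \<tau> ! 2 < \<tau> ! 0" "d < a \<longleftrightarrow> \<tau> ! 3 < \<tau> ! 0"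
    using \<tau>(2)[rule_format, of 1 0] \<tau>(2)[rule_format, of 1 2] \<tau>(2)[rule_format, of 1 3]
      \<tau>(2)[rule_format, of 2 0] \<tau>(2)[rule_format, of 3 0]
    by simp_all
  with \<tau>(1) show ?L
    by auto
qed

lemma avoids_one_line_iff:
  assumes "inj_on \<sigma> {1..m}"
  shows "avoids (one_line m \<sigma>) \<longleftrightarrow>
    (\<forall>\<tau>\<in>{[3,1,2,4], [4,1,2,3], [3,1,4,2], [4,1,3,2]}. \<not> contains_pattern m \<sigma> \<tau>)"
proof -
  let ?B = "\<lambda>i j k l. \<sigma> j < \<sigma> i \<and> \<sigma> j < \<sigma> k \<and> \<sigma> j < \<sigma> l \<and> (\<sigma> k < \<sigma> i \<or> \<sigma> l < \<sigma> i)"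
  let ?T = "{[3,1,2,4], [4,1,2,3], [3,1,4,2], [4,1,3,2]} :: nat list set"
  let ?Q = "\<lambda>\<tau> i j k l. \<forall>x<4. \<forall>y<4.
    [\<sigma> i, \<sigma> j, \<sigma> k, \<sigma> l] ! x < [\<sigma> i, \<sigma> j, \<sigma> k, \<sigma> l] ! y \<longleftrightarrow> (\<tau> :: nat list) ! x < \<tau> ! y"
  have "\<not> avoids (one_line m \<sigma>) \<longleftrightarrow>
      (\<exists>i j k l. i < j \<and> j < k \<and> k < l \<and> l < m \<and> ?B (Suc i) (Suc j) (Suc k) (Suc l))"
    unfolding avoids_conv_nth length_one_line not_not
    by (intro ex_cong1 conj_cong refl) simp_all
  also have "\<dots> \<longleftrightarrow> (\<exists>i j k l. 1 \<le> i \<and> i < j \<and> j < k \<and> k < l \<and> l \<le> m \<and> ?B i j k l)"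
    (is "?L \<longleftrightarrow> ?R")
  proof
    assume ?L
    then obtain i j k l where "i < j" "j < k" "k < l" "l < m" "?B (Suc i) (Suc j) (Suc k) (Suc l)"
      by blast
    then show ?R
      by (intro exI[of _ "Suc i"] exI[of _ "Suc j"] exI[of _ "Suc k"] exI[of _ "Suc l"]) simp
  next
    assume ?R
    then obtain i j k l where *: "1 \<le> i" "i < j" "j < k" "k < l" "l \<le> m" "?B i j k l"
      by blast
    then have "Suc (i - 1) = i" "Suc (j - 1) = j" "Suc (k - 1) = k" "Suc (l - 1) = l"
      "i - 1 < j - 1" "j - 1 < k - 1" "k - 1 < l - 1" "l - 1 < m"
      by simp_all
    with *(6) show ?L
      by metis
  qed
  also have "\<dots> \<longleftrightarrow> (\<exists>i j k l. 1 \<le> i \<and> i < j \<and> j < k \<and> k < l \<and> l \<le> m \<and> (\<exists>\<tau>\<in>?T. ?Q \<tau> i j k l))"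
  proof (intro ex_cong1 conj_cong refl)
    fix i j k l assume *: "1 \<le> i" "i < j" "j < k" "k < l" "l \<le> m"
    then have "i \<in> {1..m}" "k \<in> {1..m}" "l \<in> {1..m}" "i \<noteq> k" "i \<noteq> l" "k \<noteq> l"
      by simp_all
    then have "\<sigma> i \<noteq> \<sigma> k" "\<sigma> i \<noteq> \<sigma> l" "\<sigma> k \<noteq> \<sigma> l"
      using assms by (metis inj_onD)+
    then show "?B i j k l \<longleftrightarrow> (\<exists>\<tau>\<in>?T. ?Q \<tau> i j k l)"
      by (rule bad_quadruple_iff)
  qed
  also have "\<dots> \<longleftrightarrow> (\<exists>\<tau>\<in>?T. \<exists>i j k l. 1 \<le> i \<and> i < j \<and> j < k \<and> k < l \<and> l \<le> m \<and> ?Q \<tau> i j k l)"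
    (is "_ \<longleftrightarrow> (\<exists>\<tau>\<in>?T. ?E \<tau>)")
    by blast
  also have "\<dots> \<longleftrightarrow> (\<exists>\<tau>\<in>?T. contains_pattern m \<sigma> \<tau>)"
  proof (intro bex_cong refl)
    fix \<tau> assume "\<tau> \<in> ?T"
    then obtain a b c d where "\<tau> = [a, b, c, d]"
      by blast
    then show "?E \<tau> \<longleftrightarrow> contains_pattern m \<sigma> \<tau>"
      by (simp only: contains_pattern_4)
  qed
  finally show ?thesis by blast
qed

lemma bordered_neq:
  assumes "\<sigma> permutes {1..m}" "i \<le> m" "0 < m"
  shows "bordered m \<sigma> i \<noteq> bordered m \<sigma> (Suc i)"
proof -
  have "\<sigma> j \<in> {1..m} \<longleftrightarrow> j \<in> {1..m}" for j
    using assms(1) by (rule permutes_in_image)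
  then have pos: "0 < \<sigma> j" if "j \<in> {1..m}" for j
    using that by (metis atLeastAtMost_iff less_le_trans zero_less_one)
  have "\<sigma> i \<noteq> \<sigma> (Suc i)"
    using assms(1) by (metis permutes_def n_not_Suc_n)
  then show ?thesis
    using assms pos[of i] pos[of "Suc i"] by (auto simp: bordered_def)
qed

lemma alternating_one_line_iff:
  assumes "\<sigma> permutes {1..m}" "0 < m"
  shows "alternating 0 (one_line m \<sigma>) \<longleftrightarrow> dd m \<sigma> = 0"
proof -
  let ?w = "one_line m \<sigma>" and ?b = "bordered m \<sigma>"
  have b: "(0 # ?w) ! i = ?b i" "?w ! i = ?b (Suc i)" "(?w @ [0]) ! Suc i = ?b (Suc (Suc i))"
    if "i < m" for i
    using that by (auto simp: bordered_def nth_Cons nth_append split: nat.split)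
  have "?w \<noteq> []"
    using assms(2) by (metis length_one_line length_0_conv less_irrefl)
  then have "alternating 0 ?w \<longleftrightarrow>
      (\<forall>i<m. ?b i \<noteq> ?b (Suc i) \<and> (?b (Suc i) < ?b i \<longrightarrow> ?b (Suc i) < ?b (Suc (Suc i))))"
    unfolding alternating_conv_nth by (simp only: b length_one_line simp_thms cong: imp_cong)
  \<comment> \<open>Bordered neighbours differ, so rising after a descent is the negation of
    descending again.\<close>
  also have "\<dots> \<longleftrightarrow> (\<forall>i<m. \<not> (?b (Suc i) < ?b i \<and> ?b (Suc (Suc i)) < ?b (Suc i)))"
  proof -
    have "?b i \<noteq> ?b (Suc i)" "?b (Suc i) \<noteq> ?b (Suc (Suc i))" if "i < m" for i
      using bordered_neq[OF assms(1) _ assms(2)] that by simp_all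
    then show ?thesis
      by (meson not_less_iff_gr_or_eq)
  qed
  also have "\<dots> \<longleftrightarrow> (\<forall>i\<in>{1..m}. \<not> (?b i < ?b (i - 1) \<and> ?b (i + 1) < ?b i))"
  proof -
    have "{1..m} = Suc ` {..<m}"
      by (simp only: image_Suc_lessThan One_nat_def)
    then have "(\<forall>i\<in>{1..m}. Q i) \<longleftrightarrow> (\<forall>i<m. Q (Suc i))" for Q
      by (simp only:) blast
    then show ?thesis
      by (simp only: diff_Suc_1 Suc_eq_plus1[symmetric])
  qed
  also have "\<dots> \<longleftrightarrow> dd m \<sigma> = 0"
    by (auto simp: dd_def)
  finally show ?thesis .
qed

text \<open>A valley is always entered by a descent; without double descents every letter entered by
  a descent is a valley.\<close>

lemma val_eq_des:
  assumes "\<sigma> permutes {1..m}" "dd m \<sigma> = 0"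
  shows "val m \<sigma> = des m \<sigma>"
proof -
  let ?b = "bordered m \<sigma>"
  have dd: "\<not> (?b i < ?b (i - 1) \<and> ?b (i + 1) < ?b i)" if "i \<in> {1..m}" for i
    using assms(2) that by (auto simp: dd_def)
  have "{i \<in> {1..m}. ?b i < ?b (i - 1) \<and> ?b i < ?b (i + 1)} = {i \<in> {1..m}. ?b i < ?b (i - 1)}"
  proof (intro Collect_cong conj_cong refl)
    fix i assume "i \<in> {1..m}"
    then show "?b i < ?b (i - 1) \<and> ?b i < ?b (i + 1) \<longleftrightarrow> ?b i < ?b (i - 1)"
      using dd[of i] bordered_neq[OF assms(1), of i]
      by (metis Suc_eq_plus1 atLeastAtMost_iff less_le_trans linorder_neqE_nat zero_less_one)
  qed
  \<comment> \<open>Position 1 drops out because its left neighbour is the border 0.\<close>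
  also have "\<dots> = Suc ` {i. 1 \<le> i \<and> i < m \<and> \<sigma> (i + 1) < \<sigma> i}"
  proof (intro equalityI subsetI)
    fix i assume "i \<in> {i \<in> {1..m}. ?b i < ?b (i - 1)}"
    then show "i \<in> Suc ` {i. 1 \<le> i \<and> i < m \<and> \<sigma> (i + 1) < \<sigma> i}"
      by (intro image_eqI[of _ _ "i - 1"]) (auto simp: bordered_def split: if_splits)
  qed (auto simp: bordered_def)
  finally show ?thesis
    by (simp add: val_def des_def card_image)
qed

section \<open>Permutations correspond to words without zeros\<close>

lemma count_list_distinct: "distinct l \<Longrightarrow> count_list l x = (if x \<in> set l then 1 else 0)"
  by (induction l) auto

lemma content_0D:
  assumes "content m 0 w"
  shows "distinct w" "set w = {1..m}"
proof -
  have w: "count_list w x = (if x \<in> {1..m} then 1 else 0)" for x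
    using assms[unfolded content_def, rule_format, of x] by (cases "x = 0"; cases "x \<le> m") simp_all
  show set: "set w = {1..m}"
  proof (rule set_eqI)
    fix x
    show "x \<in> set w \<longleftrightarrow> x \<in> {1..m}"
      using w[of x] count_list_0_iff[of w x] by (metis zero_neq_one)
  qed
  \<comment> \<open>Summing multiplicities gives length \<open>m\<close>, the number of different
    letters, so no letter repeats.\<close>
  have "length w = (\<Sum>x\<in>{1..m}. count_list w x)"
    using sum_count_set[of w "{1..m}"] set by (metis finite_atLeastAtMost order_refl)
  also have "\<dots> = (\<Sum>x\<in>{1..m}. 1)"
    by (rule sum.cong[OF refl]) (simp only: w if_True)
  finally have "card (set w) = length w"
    by (simp only: set card_atLeastAtMost sum_constant) simp
  then show "distinct w"
    by (rule card_distinct)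
qed

lemma content_0_iff: "content m 0 w \<longleftrightarrow> distinct w \<and> set w = {1..m}"
proof
  show "content m 0 w \<Longrightarrow> distinct w \<and> set w = {1..m}"
    using content_0D by blast
next
  assume w: "distinct w \<and> set w = {1..m}"
  show "content m 0 w"
    unfolding content_def
  proof
    fix x
    show "count_list w x = (if x = 0 then 0 else if x \<le> m then 1 else 0)"
      using count_list_distinct[of w x] w by (cases "x = 0"; cases "x \<le> m") simp_all
  qed
qed

lemma one_line_permutes:
  assumes "\<sigma> permutes {1..m}"
  shows "distinct (one_line m \<sigma>)" "set (one_line m \<sigma>) = {1..m}"
  using permutes_image[OF assms] permutes_inj_on[OF assms]
  by (simp_all add: one_line_def distinct_map atLeastLessThanSuc_atLeastAtMost del: upt_Suc)

lemma bij_betw_one_line: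
  "bij_betw (one_line m) {\<sigma>. \<sigma> permutes {1..m}} {w. distinct w \<and> set w = {1..m}}"
proof (rule bij_betw_byWitness)
  let ?perm = "\<lambda>w i. if i \<in> {1..m} then w ! (i - 1) else i"
  show "\<forall>\<sigma>\<in>{\<sigma>. \<sigma> permutes {1..m}}. ?perm (one_line m \<sigma>) = \<sigma>"
  proof (intro ballI ext)
    fix \<sigma> i assume "\<sigma> \<in> {\<sigma>. \<sigma> permutes {1..m}}"
    then have "\<sigma> permutes {1..m}"
      by simp
    then show "?perm (one_line m \<sigma>) i = \<sigma> i"
      using permutes_not_in[of \<sigma> "{1..m}" i] by auto
  qed
  have eq: "one_line m (?perm w) = w" if "distinct w" "set w = {1..m}" for w
  proof (rule nth_equalityI)
    show "length (one_line m (?perm w)) = length w"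
      using distinct_card[OF that(1)] that(2) by simp
  qed simp
  then show "\<forall>w\<in>{w. distinct w \<and> set w = {1..m}}. one_line m (?perm w) = w"
    by blast
  show "one_line m ` {\<sigma>. \<sigma> permutes {1..m}} \<subseteq> {w. distinct w \<and> set w = {1..m}}"
    using one_line_permutes by blast
  show "?perm ` {w. distinct w \<and> set w = {1..m}} \<subseteq> {\<sigma>. \<sigma> permutes {1..m}}"
  proof (intro image_subsetI CollectI)
    fix w assume "w \<in> {w. distinct w \<and> set w = {1..m}}"
    then have "distinct (one_line m (?perm w))" "set (one_line m (?perm w)) = {1..m}"
      using eq by simp_all
    then have "bij_betw (?perm w) {1..m} {1..m}"
      unfolding one_line_def distinct_map set_map set_upt atLeastLessThanSuc_atLeastAtMost
        bij_betw_def by blast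
    then show "?perm w permutes {1..m}"
      by (rule bij_imp_permutes) (simp only: if_False)
  qed
qed

lemma bij_betw_vimage_on:
  assumes "bij_betw f A B" "C \<subseteq> B"
  shows "bij_betw f {x. x \<in> A \<and> f x \<in> C} C"
proof (rule bij_betw_subset[OF assms(1)])
  show "f ` {x. x \<in> A \<and> f x \<in> C} = C"
    using assms(2) bij_betw_imp_surj_on[OF assms(1)] by blast
qed blast

lemma bij_betw_Sset:
  assumes "0 < m"
  shows "bij_betw (one_line m) (Sset m k) {w \<in> words m 0. descents w = k}"
proof -
  have S: "Sset m k = {\<sigma>. \<sigma> permutes {1..m} \<and> one_line m \<sigma> \<in> {w \<in> words m 0. descents w = k}}"
  proof (rule set_eqI)
    fix \<sigma>
    show "\<sigma> \<in> Sset m k \<longleftrightarrow>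
      \<sigma> \<in> {\<sigma>. \<sigma> permutes {1..m} \<and> one_line m \<sigma> \<in> {w \<in> words m 0. descents w = k}}"
    proof (cases "\<sigma> permutes {1..m}")
      case True
      have "\<sigma> \<in> Sset m k \<longleftrightarrow>
          avoids (one_line m \<sigma>) \<and> dd m \<sigma> = 0 \<and> val m \<sigma> = k \<and> des m \<sigma> = k"
        unfolding Sset_def avoiders_def mem_Collect_eq
          avoids_one_line_iff[OF permutes_inj_on[OF True]] using True by blast
      also have "\<dots> \<longleftrightarrow> one_line m \<sigma> \<in> {w \<in> words m 0. descents w = k}"
        unfolding words_def content_0_iff mem_Collect_eq alternating_one_line_iff[OF True assms]
        using val_eq_des[OF True] one_line_permutes[OF True] des_eq[of m \<sigma>] by metis
      finally show ?thesis
        using True by blast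
    next
      case False
      then show ?thesis
        unfolding Sset_def avoiders_def by blast
    qed
  qed
  have "{w \<in> words m 0. descents w = k} \<subseteq> {w. distinct w \<and> set w = {1..m}}"
    unfolding words_def content_0_iff by blast
  from bij_betw_vimage_on[OF bij_betw_one_line this] show ?thesis
    unfolding S mem_Collect_eq .
qed

theorem theorem1p6:
  fixes p q t :: "'a::comm_ring_1" and n :: nat
  assumes "n \<ge> 1"
  shows "calB n p q t = (\<Sum>k = 0..n div 2. gam (n + 1) k p q * t ^ k * (1 + t) ^ (n - 2 * k))"
proof -
  let ?W = "\<lambda>k. {w \<in> words (Suc n) 0. descents w = k}"
  \<comment> \<open>For \<open>m = Suc n\<close> and \<open>k\<close> descents, the exponent
    \<open>m - (2 * k + 1)\<close> in \<open>weight\<close> is \<open>n - 2 * k\<close>.\<close>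
  have "gam (n + 1) k p q * t ^ k * (1 + t) ^ (n - 2 * k) = sum (weight p q t (Suc n)) (?W k)" for k
  proof -
    have "gam (n + 1) k p q = (\<Sum>w\<in>?W k. p ^ word_2_13 w * q ^ word_31_2 w)"
      unfolding gam_def stat_2_13_eq stat_31_2_eq
      using sum.reindex_bij_betw[OF bij_betw_Sset[of "n + 1" k],
          of "\<lambda>w. p ^ word_2_13 w * q ^ word_31_2 w"] by simp
    then show ?thesis
      by (simp add: sum_distrib_right weight_def)
  qed
  then have "(\<Sum>k = 0..n div 2. gam (n + 1) k p q * t ^ k * (1 + t) ^ (n - 2 * k)) =
      (\<Sum>k = 0..n div 2. sum (weight p q t (Suc n)) (?W k))"
    by simp
  also have "\<dots> = sum (weight p q t (Suc n)) (words (Suc n) 0)"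
  \<comment> \<open>The words are sorted by descents; \<open>2 * k + 1 \<le> n + 1\<close> shows
    that no class is missed.\<close>
  proof (rule sum.group)
    show "descents ` words (Suc n) 0 \<subseteq> {0..n div 2}"
    proof
      fix k assume "k \<in> descents ` words (Suc n) 0"
      then obtain w where "w \<in> words (Suc n) 0" "k = descents w"
        by (rule imageE)
      then show "k \<in> {0..n div 2}"
        using descents_bound[of w "Suc n" 0] by simp
    qed
  qed simp_all
  also have "\<dots> = calB n p q t"
    by (simp add: calB_eq_total total_def)
  finally show ?thesis ..
qed

end
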